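(* For every positive integer $r$ there is an integer $m$ such that $$c\phi_{13}\left(13^{2r}m+\frac{13-13^{2r+1}}{24}\right)\not\equiv0\pmod{13}.$$
   Context: For $k\ge2$, $c\phi_k(n)$ denotes the number of $k$-colored generalized Frobenius partitions of $n$, given by the generating function $$\sum_{n\ge0}c\phi_k(n)q^n=\prod_{n\ge1}\frac{1}{(1-q^n)^k}\sum_{(m_1,\dots,m_{k-1})\in\mathbb{Z}^{k-1}}q^{Q(m_1,\dots,m_{k-1})},\qquad Q(m_1,\dots,m_{k-1})=\sum_{i=1}^{k-1}m_i^2+\sum_{1\le i<j\le k-1}m_im_j,$$ with $c\phi_k(n)=0$ for $n<0$. *)

theory Defs
  imports "HOL-Analysis.Analysis" "HOL-Number_Theory.Cong"
begin

definition frob_form :: "nat \<Rightarrow> (nat \<Rightarrow> int) \<Rightarrow> int" where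
  "frob_form k m = (\<Sum>i=1..k-1. (m i)\<^sup>2) + (\<Sum>j=1..k-1. \<Sum>i=1..<j. m i * m j)"

(* The index set {1..k-1} \<rightarrow>\<^sub>E UNIV is Z^(k-1). The conversion to nat loses nothing since
   frob_form is nonnegative (frob_form_nonneg), and the family is summable in the topology
   of formal power series (frob_theta_has_sum). *)
definition frob_theta :: "nat \<Rightarrow> int fps" where
  "frob_theta k = (\<Sum>\<^sub>\<infinity>m\<in>{1..k-1} \<rightarrow>\<^sub>E UNIV. fps_X ^ nat (frob_form k m))"

(* 1/(1-q^n)^k as a series with integer coefficients; the class-based inverse for fps is not
   available over int. See frob_factor_correct. *)
definition frob_factor :: "nat \<Rightarrow> nat \<Rightarrow> int fps" where
  "frob_factor k n = fps_right_inverse ((1 - fps_X ^ n) ^ k) 1"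

(* The library indexes infinite products from 0, hence Suc n. Convergence: frob_factor_has_prod. *)
definition cphi_gf :: "nat \<Rightarrow> int fps" where
  "cphi_gf k = (\<Prod>n. frob_factor k (Suc n)) * frob_theta k"

definition cphi :: "nat \<Rightarrow> int \<Rightarrow> int" where
  "cphi k n = (if n < 0 then 0 else fps_nth (cphi_gf k) (nat n))"

lemma frob_form_double:
  "2 * frob_form k m = (\<Sum>i=1..k-1. (m i)\<^sup>2) + (\<Sum>i=1..k-1. m i)\<^sup>2"
proof -
  have "2 * ((\<Sum>i=1..N. (m i)\<^sup>2) + (\<Sum>j=1..N. \<Sum>i=1..<j. m i * m j))
      = (\<Sum>i=1..N. (m i)\<^sup>2) + (\<Sum>i=1..N. m i)\<^sup>2" for N
  proof (induction N)
    case (Suc N)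
    have "{1..<Suc N} = {1..N}" by auto
    then have "(\<Sum>i=1..<Suc N. m i * m (Suc N)) = (\<Sum>i=1..N. m i) * m (Suc N)"
      by (simp only: sum_distrib_right)
    with Suc show ?case
      by (simp add: power2_eq_square algebra_simps)
  qed simp
  then show ?thesis by (simp add: frob_form_def)
qed

lemma frob_form_nonneg: "0 \<le> frob_form k m"
proof -
  have "0 \<le> (\<Sum>i=1..k-1. (m i)\<^sup>2)" by (simp add: sum_nonneg)
  then have "0 \<le> 2 * frob_form k m" unfolding frob_form_double by simp
  then show ?thesis by simp
qed

lemma frob_form_fibre_finite: "finite {m \<in> {1..k-1} \<rightarrow>\<^sub>E UNIV. frob_form k m = c}"
proof (rule finite_subset)
  show "{m \<in> {1..k-1} \<rightarrow>\<^sub>E UNIV. frob_form k m = c} \<subseteq> {1..k-1} \<rightarrow>\<^sub>E {-(2*c)..2*c}"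
  proof (clarify intro!: PiE_I)
    fix m assume m: "m \<in> {1..k-1} \<rightarrow>\<^sub>E (UNIV :: int set)"
    show "m \<in> {1..k-1} \<rightarrow>\<^sub>E {-(2*frob_form k m)..2*frob_form k m}"
    proof (rule PiE_I)
      fix i assume i: "i \<in> {1..k-1}"
      have "(m i)\<^sup>2 \<le> (\<Sum>i=1..k-1. (m i)\<^sup>2)"
        using i by (intro member_le_sum) auto
      also have "\<dots> \<le> 2 * frob_form k m" unfolding frob_form_double by simp
      finally have le: "(m i)\<^sup>2 \<le> 2 * frob_form k m" .
      have "\<bar>m i\<bar> \<le> (m i)\<^sup>2"
      proof (cases "m i = 0")
        case False
        then have "\<bar>m i\<bar> * 1 \<le> \<bar>m i\<bar> * \<bar>m i\<bar>" by (intro mult_left_mono) auto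
        then show ?thesis by (simp add: power2_eq_square)
      qed simp
      with le show "m i \<in> {-(2*frob_form k m)..2*frob_form k m}" by auto
    qed (use m in auto)
  qed
  show "finite ({1..k-1} \<rightarrow>\<^sub>E {-(2*c)..2*c})" by (intro finite_PiE) auto
qed

lemma frob_theta_has_sum:
  "((\<lambda>m. fps_X ^ nat (frob_form k m) :: int fps) has_sum
     Abs_fps (\<lambda>n. int (card {m \<in> {1..k-1} \<rightarrow>\<^sub>E UNIV. frob_form k m = int n})))
     ({1..k-1} \<rightarrow>\<^sub>E UNIV)"
proof (rule has_sum_fpsI)
  fix n
  have eq: "{m \<in> {1..k-1} \<rightarrow>\<^sub>E UNIV. fps_nth (fps_X ^ nat (frob_form k m) :: int fps) n \<noteq> 0}
     = {m \<in> {1..k-1} \<rightarrow>\<^sub>E UNIV. frob_form k m = int n}"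
    using frob_form_nonneg by (auto simp: fps_X_power_nth)
  then show "finite {m \<in> {1..k-1} \<rightarrow>\<^sub>E UNIV. fps_nth (fps_X ^ nat (frob_form k m) :: int fps) n \<noteq> 0}"
    using frob_form_fibre_finite[of k "int n"] by (simp only: eq)
  show "fps_nth (Abs_fps (\<lambda>n. int (card {m \<in> {1..k-1} \<rightarrow>\<^sub>E UNIV. frob_form k m = int n}))) n
     = (\<Sum>m | m \<in> {1..k-1} \<rightarrow>\<^sub>E UNIV \<and> fps_nth (fps_X ^ nat (frob_form k m) :: int fps) n \<noteq> 0.
          fps_nth (fps_X ^ nat (frob_form k m)) n)"
    unfolding eq by (simp add: fps_X_power_nth)
qed

lemma frob_factor_correct:
  assumes "n > 0"
  shows "(1 - fps_X ^ n) ^ k * frob_factor k n = 1"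
  unfolding frob_factor_def
  by (rule fps_right_inverse) (use assms in \<open>simp add: fps_nth_power_0 zero_power\<close>)

lemma frob_factor_expand:
  assumes "n > 0"
  obtains g where "frob_factor k n = 1 + fps_X ^ n * g"
proof -
  have "\<exists>u. (1 - fps_X ^ n) ^ k = 1 - fps_X ^ n * (u :: int fps)"
  proof (induction k)
    case 0
    show ?case by (rule exI[of _ 0]) simp
  next
    case (Suc k)
    then obtain u where u: "(1 - fps_X ^ n) ^ k = 1 - fps_X ^ n * (u :: int fps)" by blast
    show ?case
      by (rule exI[of _ "1 + u - fps_X ^ n * u"]) (simp add: u algebra_simps)
  qed
  then obtain u where "(1 - fps_X ^ n) ^ k = 1 - fps_X ^ n * (u :: int fps)" by blast
  with frob_factor_correct[OF assms, of k]
  have "(1 - fps_X ^ n * u) * frob_factor k n = 1" by simp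
  then have "frob_factor k n = 1 + fps_X ^ n * (u * frob_factor k n)"
    by (simp add: algebra_simps)
  then show thesis by (rule that)
qed

lemma frob_factor_has_prod:
  "(\<lambda>n. frob_factor k (Suc n)) has_prod (\<Prod>n. frob_factor k (Suc n))"
  and frob_factor_prod_nth:
  "m \<le> n \<Longrightarrow> fps_nth (\<Prod>n. frob_factor k (Suc n)) m = fps_nth (\<Prod>i\<le>n. frob_factor k (Suc i)) m"
proof -
  define f where "f = (\<lambda>n. frob_factor k (Suc n))"
  define P where "P = Abs_fps (\<lambda>m. fps_nth (\<Prod>i\<le>m. f i) m)"
  have stable: "fps_nth (\<Prod>i\<le>n. f i) m = fps_nth P m" if "m \<le> n" for m n
    using that
  proof (induction n rule: dec_induct)
    case base
    show ?case by (simp add: P_def)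
  next
    case (step n)
    obtain g where g: "f (Suc n) = 1 + fps_X ^ Suc (Suc n) * g"
      unfolding f_def using frob_factor_expand[of "Suc (Suc n)" k] by auto
    have "(\<Prod>i\<le>Suc n. f i) = (\<Prod>i\<le>n. f i) + fps_X ^ Suc (Suc n) * (g * (\<Prod>i\<le>n. f i))"
      unfolding prod.atMost_Suc g by (simp add: algebra_simps del: power_Suc)
    then have "fps_nth (\<Prod>i\<le>Suc n. f i) m = fps_nth (\<Prod>i\<le>n. f i) m"
      using step.hyps by (simp only: fps_add_nth fps_X_power_mult_nth) simp
    with step.IH show ?case by simp
  qed
  have lim: "(\<lambda>n. \<Prod>i\<le>n. f i) \<longlonglongrightarrow> P"
    by (rule tendsto_fpsI) (use stable in \<open>auto simp: eventually_at_top_linorder\<close>)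
  have nz: "f i \<noteq> 0" for i
    using frob_factor_correct[of "Suc i" k] unfolding f_def by auto
  have "fps_nth (f 0) 0 = 1"
    using frob_factor_expand[of "Suc 0" k] unfolding f_def by fastforce
  then have "fps_nth P 0 = 1" by (simp add: P_def)
  then have "P \<noteq> 0" by auto
  with lim have raw: "raw_has_prod f 0 P" by (simp add: raw_has_prod_def)
  have "prodinf f = P"
    unfolding prodinf_def
  proof (rule the_equality)
    show "f has_prod P" using raw by (simp add: has_prod_def)
    show "p = P" if "f has_prod p" for p
      using that nz lim LIMSEQ_unique by (auto simp: has_prod_def raw_has_prod_def)
  qed
  with raw stable show "(\<lambda>n. frob_factor k (Suc n)) has_prod (\<Prod>n. frob_factor k (Suc n))"
    and "m \<le> n \<Longrightarrow> fps_nth (\<Prod>n. frob_factor k (Suc n)) m = fps_nth (\<Prod>i\<le>n. frob_factor k (Suc i)) m"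
    by (simp_all add: has_prod_def f_def)
qed

(* The division by 24 in the argument of cphi is exact. *)
lemma frob_shift_dvd: "(24 :: int) dvd 13 - 13 ^ (2 * r + 1)"
proof -
  have "[(169 :: int) ^ r = 1 ^ r] (mod 24)" by (intro cong_pow) (simp add: cong_def)
  then have "24 dvd (1 - 169 ^ r :: int)" by (simp add: cong_iff_dvd_diff dvd_diff_commute)
  then have "24 dvd 13 * (1 - 169 ^ r :: int)" by (rule dvd_mult)
  then show ?thesis by (simp add: power_mult)
qed

end

theory Submission
  imports Defs "HOL-Library.Numeral_Type"
begin

text \<open>
  Let \<open>F = (\<Prod>n\<ge>1. 1 / (1 - q^n))\<close> be the generating function of the partition numbers \<open>p(n)\<close> and
  \<open>E = 1 / F\<close>. The sum over \<open>m\<close> in the definition of \<open>c\<phi>\<^sub>1\<^sub>3\<close> is the theta series of the root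
  lattice \<open>A\<^sub>1\<^sub>2\<close>, that is, of the vectors with thirteen integer coordinates and sum zero. Cyclic rotation
  of the coordinates has order 13 and fixes only the zero vector, so this theta series is congruent to 1
  modulo 13. Hence the generating function of \<open>c\<phi>\<^sub>1\<^sub>3\<close> is congruent to \<open>F^13\<close>, which is \<open>F(q^13)\<close>
  modulo 13, and \<open>c\<phi>\<^sub>1\<^sub>3(13 n)\<close> is congruent to \<open>p(n)\<close>. What has to be shown is that \<open>p\<close> does not vanish
  modulo 13 identically on the progressions \<open>24 n \<equiv> 1\<close> modulo odd powers of 13.

  Write \<open>section13 j f\<close> for the series of the coefficients of \<open>f\<close> at \<open>13 n + j\<close>. The core of the proof
  consists of three congruences modulo 13, lemmas \<open>section13_euler13_12\<close>, \<open>section13_euler13_24\<close> and \<open>section13_euler13_36\<close>: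
  \<open>section13 6 (E^12) = 11 E^12\<close>, \<open>section13 12 (E^24) = 8 E^24\<close> and \<open>section13 5 (E^36) = 4 E^12\<close>. They
  say how the operator \<open>U\<^sub>1\<^sub>3\<close> acts on the 12th, 24th and 36th power of the eta function. Since a factor
  \<open>f^13\<close> is a series in \<open>q^13\<close> and passes through \<open>section13\<close>, they give
  \<open>section13 6 F = 11 E^11\<close>, \<open>section13 12 (E^11) = 8 E^23\<close> and \<open>section13 5 (E^23) = 4 E^11\<close>. Iterating, the
  values of \<open>p\<close> on each of the progressions in question are the coefficients of a non-zero multiple
  of \<open>E^11\<close>, whose constant term does not vanish. The constant term is reached for \<open>m = 1\<close>.

  To prove the three congruences, let \<open>\<theta> = q d/dq\<close>. By Fermat's little theorem,
  \<open>f - (\<theta> + 13 - j)^12 f = q^j (section13 j f)^13\<close> modulo 13 (lemma \<open>section13_fermat\<close>), so that it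
  suffices to compute an iterated derivative. With Ramanujan's Eisenstein series \<open>P, Q, R\<close> of weights
  2, 4, 6 one has \<open>(\<theta> + k/24) (E^k u) = E^k (\<theta> u + (k/24) P u)\<close>. Modulo 13 the weight 12 and the
  weight 14 Eisenstein series reduce to 1 and to \<open>P\<close>, whence \<open>R^2 = 9 Q^3 + 5\<close> and \<open>P = Q^2 R\<close>, and the
  computation takes place among polynomials in \<open>Q\<close> alone. There it is finite.

  The relations between Eisenstein series that this uses are Ramanujan's differential equations for
  \<open>Q\<close> and \<open>R\<close>, the formula \<open>Q^3 - R^2 = 1728 q E^24\<close>, and the expressions for the series of weights 12 and
  14. All of them follow from one elementary identity for sums over the solutions of \<open>a x + b y = n\<close>,
  lemma \<open>reps_sum_symmetric\<close>, applied to five polynomials.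
\<close>

section \<open>Sums over the solutions of ax + by = n\<close>

text \<open>
  The constant term is 0, so that the coefficients of a product are convolution sums over positive
  integers and the constant terms of Eisenstein series have to be added by hand.
\<close>

definition sigma_gf :: "nat \<Rightarrow> int fps" where
  "sigma_gf k = Abs_fps (\<lambda>n. if n = 0 then 0 else \<Sum>d | d dvd n. int d ^ k)"

definition reps :: "nat \<Rightarrow> (nat \<times> nat \<times> nat \<times> nat) set" where
  "reps n = {(a, b, x, y). 0 < a \<and> 0 < b \<and> 0 < x \<and> 0 < y \<and> a * x + b * y = n}"

lemma dvd_div_pos: "d dvd n \<Longrightarrow> 0 < n \<Longrightarrow> 0 < n div (d :: nat)"
  by (metis dvd_div_eq_0_iff gr0I)

lemma finite_reps: "finite (reps n)"
proof (rule finite_subset)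
  show "reps n \<subseteq> {..n} \<times> {..n} \<times> {..n} \<times> {..n}"
  proof (clarsimp simp: reps_def)
    fix a b x y :: nat
    assume "0 < a" "0 < b" "0 < x" "0 < y"
    then have "a \<le> a * x" "x \<le> a * x" "b \<le> b * y" "y \<le> b * y" by auto
    then show "a \<le> a * x + b * y \<and> b \<le> a * x + b * y \<and> x \<le> a * x + b * y \<and> y \<le> a * x + b * y"
      by linarith
  qed
qed simp

text \<open>
  A divisor \<open>a\<close> of \<open>k\<close> and a divisor \<open>b\<close> of \<open>n - k\<close> are the same as a solution of \<open>a x + b y = n\<close>
  with \<open>a x = k\<close>.
\<close>

lemma sigma_gf_mult_nth:
  "fps_nth (sigma_gf i * sigma_gf j) n
     = (\<Sum>(a, b, x, y)\<in>reps n. int a ^ i * int b ^ j)"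
proof -
  let ?K = "SIGMA k:{0<..<n}. {a. a dvd k} \<times> {b. b dvd n - k}"
  have "fps_nth (sigma_gf i * sigma_gf j) n
      = (\<Sum>k=0..n. fps_nth (sigma_gf i) k * fps_nth (sigma_gf j) (n - k))"
    by (simp add: fps_mult_nth)
  also have "\<dots> = (\<Sum>k\<in>{0<..<n}. fps_nth (sigma_gf i) k * fps_nth (sigma_gf j) (n - k))"
    by (rule sum.mono_neutral_right) (auto simp: sigma_gf_def)
  also have "\<dots> = (\<Sum>k\<in>{0<..<n}. \<Sum>(a, b)\<in>{a. a dvd k} \<times> {b. b dvd n - k}. int a ^ i * int b ^ j)"
    by (rule sum.cong) (auto simp: sigma_gf_def sum_product sum.cartesian_product)
  also have "\<dots> = (\<Sum>(k, a, b)\<in>?K. int a ^ i * int b ^ j)"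
    by (subst sum.Sigma) (auto simp: case_prod_unfold)
  also have "\<dots> = (\<Sum>(a, b, x, y)\<in>reps n. int a ^ i * int b ^ j)"
    by (rule sum.reindex_bij_witness[where i = "\<lambda>(a, b, x, y). (a * x, a, b)"
          and j = "\<lambda>(k, a, b). (a, b, k div a, (n - k) div b)"])
       (auto simp: reps_def dvd_div_pos elim: dvdE intro: dvd_pos_nat[where n = "n - _"])
  finally show ?thesis .
qed

text \<open>
  One step of the Euclidean algorithm. Since \<open>a x + b y = a (x - y) + (a + b) y\<close>, the map
  \<open>(a, b, x, y) \<mapsto> (a, a + b, x - y, y)\<close> sends the solutions with \<open>x > y\<close> bijectively to those with \<open>a < b\<close>.
  It turns \<open>h a (a + b)\<close> into \<open>h a b\<close>. The mirror image of this map does the same for \<open>x < y\<close> and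
  \<open>a > b\<close>; this is where the two symmetries of \<open>h\<close> enter. What remains on the two sides are the
  solutions with \<open>x = y\<close> and those with \<open>a = b\<close>, which are parametrised by the divisors of \<open>n\<close>.
\<close>

lemma reps_sum_symmetric:
  fixes h :: "int \<Rightarrow> int \<Rightarrow> int"
  assumes sym: "\<And>s t. h s t = h t s" and refl: "\<And>s t. h s t = h (t - s) t" and "n > 0"
  shows "(\<Sum>(a, b, x, y)\<in>reps n. h (int a) (int a + int b) - h (int a) (int b))
    = (\<Sum>d | d dvd n. (\<Sum>a=1..<d. h (int a) (int d)) - (int (n div d) - 1) * h (int d) (int d))"
proof -
  define G where "G = (\<lambda>(a :: nat, b :: nat, x :: nat, y :: nat). h (int a) (int a + int b))"
  define H where "H = (\<lambda>(a :: nat, b :: nat, x :: nat, y :: nat). h (int a) (int b))"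
  define pos where "pos R = reps n \<inter> {(a, b, x, y). R a b x y}" for R
  note fin = finite_reps[of n]
  have split: "sum g (reps n) = sum g (pos P) + sum g (pos Q) + sum g (pos R)"
    if "\<And>a b x y. (P a b x y \<and> \<not> Q a b x y \<and> \<not> R a b x y) \<or> (\<not> P a b x y \<and> Q a b x y \<and> \<not> R a b x y)
          \<or> (\<not> P a b x y \<and> \<not> Q a b x y \<and> R a b x y)" for P Q R and g :: "_ \<Rightarrow> int"
  proof -
    have "reps n = pos P \<union> pos Q \<union> pos R"
      using that by (fastforce simp: pos_def)
    moreover have "pos P \<inter> pos Q = {}" "(pos P \<union> pos Q) \<inter> pos R = {}"
      using that by (fastforce simp: pos_def)+
    ultimately show ?thesis
      using fin by (metis (no_types, lifting) finite_Un sum.union_disjoint)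
  qed
  have 1: "sum G (pos (\<lambda>a b x y. y < x)) = sum H (pos (\<lambda>a b x y. a < b))"
    by (rule sum.reindex_bij_witness[where j = "\<lambda>(a, b, x, y). (a, a + b, x - y, y)"
          and i = "\<lambda>(a, b, x, y). (a, b - a, x + y, y)"])
       (auto simp: pos_def reps_def G_def H_def algebra_simps trans_le_add1)
  have 2: "sum G (pos (\<lambda>a b x y. x < y)) = sum H (pos (\<lambda>a b x y. b < a))"
  proof (rule sum.reindex_bij_witness[where j = "\<lambda>(a, b, x, y). (a + b, b, x, y - x)"
          and i = "\<lambda>(a, b, x, y). (a - b, b, x, x + y)"])
    fix q assume "q \<in> pos (\<lambda>a b x y. x < y)"
    obtain a b x y where q: "q = (a, b, x, y)" by (metis prod_cases4)
    have "h (int a + int b) (int b) = h (int b) (int a + int b)" by (rule sym)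
    also have "\<dots> = h (int a) (int a + int b)" by (subst refl) simp
    finally show "H (case q of (a, b, x, y) \<Rightarrow> (a + b, b, x, y - x)) = G q"
      by (simp add: q G_def H_def)
  qed (auto simp: pos_def reps_def algebra_simps trans_le_add1)
  have 3: "sum G (pos (\<lambda>a b x y. x = y)) = (\<Sum>d | d dvd n. \<Sum>a=1..<d. h (int a) (int d))"
  proof -
    have "sum G (pos (\<lambda>a b x y. x = y))
        = (\<Sum>(d, a)\<in>(SIGMA d:{d. d dvd n}. {1..<d}). h (int a) (int d))"
      by (rule sum.reindex_bij_witness[where j = "\<lambda>(a, b, x, y). (a + b, a)"
            and i = "\<lambda>(d, a). (a, d - a, n div d, n div d)"])
         (use \<open>n > 0\<close> in \<open>auto simp: pos_def reps_def G_def dvd_div_pos simp flip: add_mult_distrib\<close>)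
    then show ?thesis using \<open>n > 0\<close> by (simp add: sum.Sigma)
  qed
  have 4: "sum H (pos (\<lambda>a b x y. a = b)) = (\<Sum>d | d dvd n. (int (n div d) - 1) * h (int d) (int d))"
  proof -
    have "sum H (pos (\<lambda>a b x y. a = b))
        = (\<Sum>(d, x)\<in>(SIGMA d:{d. d dvd n}. {1..<n div d}). h (int d) (int d))"
      by (rule sum.reindex_bij_witness[where j = "\<lambda>(a, b, x, y). (a, x)"
            and i = "\<lambda>(d, x). (d, d, x, n div d - x)"])
         (use \<open>n > 0\<close> in \<open>auto simp: pos_def reps_def H_def dvd_pos_nat simp flip: add_mult_distrib2\<close>)
    also have "\<dots> = (\<Sum>d | d dvd n. \<Sum>x=1..<n div d. h (int d) (int d))"
      using \<open>n > 0\<close> by (subst sum.Sigma) auto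
    also have "\<dots> = (\<Sum>d | d dvd n. (int (n div d) - 1) * h (int d) (int d))"
      using \<open>n > 0\<close> by (intro sum.cong) (auto simp: of_nat_diff dvd_div_pos Suc_leI)
    finally show ?thesis .
  qed
  have "(\<Sum>(a, b, x, y)\<in>reps n. h (int a) (int a + int b) - h (int a) (int b))
      = (\<Sum>q\<in>reps n. G q - H q)"
    by (rule sum.cong) (auto simp: G_def H_def)
  also have "\<dots> = sum G (reps n) - sum H (reps n)"
    by (rule sum_subtractf)
  also have "sum G (reps n) = sum G (pos (\<lambda>a b x y. y < x)) + sum G (pos (\<lambda>a b x y. x < y))
      + sum G (pos (\<lambda>a b x y. x = y))"
    by (rule split) linarith
  also have "sum H (reps n) = sum H (pos (\<lambda>a b x y. a < b)) + sum H (pos (\<lambda>a b x y. b < a))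
      + sum H (pos (\<lambda>a b x y. a = b))"
    by (rule split) linarith
  finally show ?thesis by (simp only: 1 2 3 4 sum_subtractf add_diff_cancel_left)
qed

section \<open>Quadratic relations between divisor series\<close>

lemma power_sums:
  fixes m :: nat
  shows "2 * (\<Sum>a=1..<m. int a) = int m ^ 2 - int m"
    and "6 * (\<Sum>a=1..<m. int a ^ 2) = 2 * int m ^ 3 - 3 * int m ^ 2 + int m"
    and "4 * (\<Sum>a=1..<m. int a ^ 3) = int m ^ 4 - 2 * int m ^ 3 + int m ^ 2"
    and "30 * (\<Sum>a=1..<m. int a ^ 4) = 6 * int m ^ 5 - 15 * int m ^ 4 + 10 * int m ^ 3 - int m"
    and "12 * (\<Sum>a=1..<m. int a ^ 5) = 2 * int m ^ 6 - 6 * int m ^ 5 + 5 * int m ^ 4 - int m ^ 2"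
    and "42 * (\<Sum>a=1..<m. int a ^ 6) = 6 * int m ^ 7 - 21 * int m ^ 6 + 21 * int m ^ 5 - 7 * int m ^ 3 + int m"
    and "24 * (\<Sum>a=1..<m. int a ^ 7) = 3 * int m ^ 8 - 12 * int m ^ 7 + 14 * int m ^ 6 - 7 * int m ^ 4 + 2 * int m ^ 2"
    and "90 * (\<Sum>a=1..<m. int a ^ 8) = 10 * int m ^ 9 - 45 * int m ^ 8 + 60 * int m ^ 7 - 42 * int m ^ 5 + 20 * int m ^ 3 - 3 * int m"
proof -
  have closed_form: "c * (\<Sum>a=1..<m. int a ^ k) = F m"
    if "F 0 = 0" "\<And>m. F (Suc m) = F m + c * int m ^ k" "k > 0" for F :: "nat \<Rightarrow> int" and c k
  proof (induction m)
    case (Suc m)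
    have "(\<Sum>a=1..<Suc m. int a ^ k) = (\<Sum>a=1..<m. int a ^ k) + int m ^ k"
      using \<open>k > 0\<close> by (cases "m = 0") auto
    with Suc that(2)[of m] show ?case by (simp add: algebra_simps)
  qed (simp add: that)
  show "2 * (\<Sum>a=1..<m. int a) = int m ^ 2 - int m"
    using closed_form[of "\<lambda>m. int m ^ 2 - int m" 2 1] by (simp add: power2_eq_square algebra_simps)
  show "6 * (\<Sum>a=1..<m. int a ^ 2) = 2 * int m ^ 3 - 3 * int m ^ 2 + int m"
    by (rule closed_form) (simp, simp only: of_nat_Suc, algebra, simp)
  show "4 * (\<Sum>a=1..<m. int a ^ 3) = int m ^ 4 - 2 * int m ^ 3 + int m ^ 2"
    by (rule closed_form) (simp, simp only: of_nat_Suc, algebra, simp)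
  show "30 * (\<Sum>a=1..<m. int a ^ 4) = 6 * int m ^ 5 - 15 * int m ^ 4 + 10 * int m ^ 3 - int m"
    by (rule closed_form) (simp, simp only: of_nat_Suc, algebra, simp)
  show "12 * (\<Sum>a=1..<m. int a ^ 5) = 2 * int m ^ 6 - 6 * int m ^ 5 + 5 * int m ^ 4 - int m ^ 2"
    by (rule closed_form) (simp, simp only: of_nat_Suc, algebra, simp)
  show "42 * (\<Sum>a=1..<m. int a ^ 6) = 6 * int m ^ 7 - 21 * int m ^ 6 + 21 * int m ^ 5 - 7 * int m ^ 3 + int m"
    by (rule closed_form) (simp, simp only: of_nat_Suc, algebra, simp)
  show "24 * (\<Sum>a=1..<m. int a ^ 7) = 3 * int m ^ 8 - 12 * int m ^ 7 + 14 * int m ^ 6 - 7 * int m ^ 4 + 2 * int m ^ 2"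
    by (rule closed_form) (simp, simp only: of_nat_Suc, algebra, simp)
  show "90 * (\<Sum>a=1..<m. int a ^ 8) = 10 * int m ^ 9 - 45 * int m ^ 8 + 60 * int m ^ 7 - 42 * int m ^ 5 + 20 * int m ^ 3 - 3 * int m"
    by (rule closed_form) (simp, simp only: of_nat_Suc, algebra, simp)
qed

lemma reps_sum_const_monom:
  "(\<Sum>(a, b, x, y)\<in>reps n. c * int a ^ i * int b ^ j) = c * fps_nth (sigma_gf i * sigma_gf j) n"
  unfolding sigma_gf_mult_nth by (simp add: sum_distrib_left case_prod_unfold mult.assoc)

text \<open>
  The substitutions \<open>(s, t) \<mapsto> (t, s)\<close> and \<open>(s, t) \<mapsto> (t - s, t)\<close> generate a dihedral group acting on a
  hexagonal lattice. The norm form of the lattice and the square of the product of its three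
  short linear forms are invariant, so every polynomial in them can serve as the function \<open>h\<close> of
  \<open>reps_sum_symmetric\<close>.
\<close>

abbreviation hex_norm :: "int \<Rightarrow> int \<Rightarrow> int" where
  "hex_norm s t \<equiv> s\<^sup>2 - s * t + t\<^sup>2"

abbreviation hex_disc :: "int \<Rightarrow> int \<Rightarrow> int" where
  "hex_disc s t \<equiv> (s * t * (s - t))\<^sup>2"

text \<open>
  For the five polynomials \<open>h\<close> used below, the inner sums on the divisor side of
  \<open>reps_sum_symmetric\<close> are polynomials in \<open>d\<close> by Faulhaber's formulas.
\<close>

lemma sum_hex_norm_sq:
  "30 * (\<Sum>a=1..<d. hex_norm (int a) (int d) ^ 2)
    = - int d + 10 * int d ^ 3 - 30 * int d ^ 4 + 21 * int d ^ 5"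
proof (cases "d = 0")
  case False
  have "(\<Sum>a=1..<d. hex_norm (int a) (int d) ^ 2)
     = (\<Sum>a=1..<d. int a ^ 4 - 2 * int d * int a ^ 3 + 3 * int d ^ 2 * int a ^ 2 - 2 * int d ^ 3 * int a + int d ^ 4)"
    by (rule sum.cong) (simp, algebra)
  also have "\<dots> = (\<Sum>a=1..<d. int a ^ 4) - 2 * int d * (\<Sum>a=1..<d. int a ^ 3)
      + 3 * int d ^ 2 * (\<Sum>a=1..<d. int a ^ 2) - 2 * int d ^ 3 * (\<Sum>a=1..<d. int a) + (int d - 1) * int d ^ 4"
    using False by (simp add: sum.distrib sum_subtractf sum_distrib_left of_nat_diff Suc_leI)
  finally show ?thesis using power_sums[of d] by algebra
qed simp

lemma sum_hex_disc:
  "30 * (\<Sum>a=1..<d. hex_disc (int a) (int d)) = - (int d ^ 3) + int d ^ 7"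
proof -
  have "(\<Sum>a=1..<d. hex_disc (int a) (int d))
     = (\<Sum>a=1..<d. int d ^ 2 * int a ^ 4 - 2 * int d ^ 3 * int a ^ 3 + int d ^ 4 * int a ^ 2)"
    by (rule sum.cong) (simp, algebra)
  also have "\<dots> = int d ^ 2 * (\<Sum>a=1..<d. int a ^ 4) - 2 * int d ^ 3 * (\<Sum>a=1..<d. int a ^ 3)
      + int d ^ 4 * (\<Sum>a=1..<d. int a ^ 2)"
    by (simp add: sum.distrib sum_subtractf sum_distrib_left)
  finally show ?thesis using power_sums[of d] by algebra
qed

lemma sum_hex_norm_cube:
  "420 * (\<Sum>a=1..<d. hex_norm (int a) (int d) ^ 3)
    = 10 * int d - 49 * int d ^ 3 + 210 * int d ^ 5 - 420 * int d ^ 6 + 249 * int d ^ 7"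
proof (cases "d = 0")
  case False
  have "(\<Sum>a=1..<d. hex_norm (int a) (int d) ^ 3)
     = (\<Sum>a=1..<d. int a ^ 6 - 3 * int d * int a ^ 5 + 6 * int d ^ 2 * int a ^ 4 - 7 * int d ^ 3 * int a ^ 3
         + 6 * int d ^ 4 * int a ^ 2 - 3 * int d ^ 5 * int a + int d ^ 6)"
    by (rule sum.cong) (simp, algebra)
  also have "\<dots> = (\<Sum>a=1..<d. int a ^ 6) - 3 * int d * (\<Sum>a=1..<d. int a ^ 5)
      + 6 * int d ^ 2 * (\<Sum>a=1..<d. int a ^ 4) - 7 * int d ^ 3 * (\<Sum>a=1..<d. int a ^ 3)
      + 6 * int d ^ 4 * (\<Sum>a=1..<d. int a ^ 2) - 3 * int d ^ 5 * (\<Sum>a=1..<d. int a) + (int d - 1) * int d ^ 6"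
    using False by (simp add: sum.distrib sum_subtractf sum_distrib_left of_nat_diff Suc_leI)
  finally show ?thesis using power_sums[of d] by algebra
qed simp

lemma sum_hex_norm_sq_disc:
  "630 * (\<Sum>a=1..<d. hex_norm (int a) (int d) ^ 2 * hex_disc (int a) (int d))
    = - 21 * int d ^ 3 + 50 * int d ^ 5 - 42 * int d ^ 7 + 13 * int d ^ 11"
proof -
  have "(\<Sum>a=1..<d. hex_norm (int a) (int d) ^ 2 * hex_disc (int a) (int d))
     = (\<Sum>a=1..<d. int d ^ 2 * int a ^ 8 - 4 * int d ^ 3 * int a ^ 7 + 8 * int d ^ 4 * int a ^ 6
         - 10 * int d ^ 5 * int a ^ 5 + 8 * int d ^ 6 * int a ^ 4 - 4 * int d ^ 7 * int a ^ 3 + int d ^ 8 * int a ^ 2)"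
    by (rule sum.cong) (simp, algebra)
  also have "\<dots> = int d ^ 2 * (\<Sum>a=1..<d. int a ^ 8) - 4 * int d ^ 3 * (\<Sum>a=1..<d. int a ^ 7)
      + 8 * int d ^ 4 * (\<Sum>a=1..<d. int a ^ 6) - 10 * int d ^ 5 * (\<Sum>a=1..<d. int a ^ 5)
      + 8 * int d ^ 6 * (\<Sum>a=1..<d. int a ^ 4) - 4 * int d ^ 7 * (\<Sum>a=1..<d. int a ^ 3)
      + int d ^ 8 * (\<Sum>a=1..<d. int a ^ 2)"
    by (simp add: sum.distrib sum_subtractf sum_distrib_left)
  finally show ?thesis using power_sums[of d] by algebra
qed

lemma sum_hex_disc_sq:
  "630 * (\<Sum>a=1..<d. hex_disc (int a) (int d) ^ 2)
    = - 21 * int d ^ 5 + 20 * int d ^ 7 + int d ^ 13"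
proof -
  have "(\<Sum>a=1..<d. hex_disc (int a) (int d) ^ 2)
     = (\<Sum>a=1..<d. int d ^ 4 * int a ^ 8 - 4 * int d ^ 5 * int a ^ 7 + 6 * int d ^ 6 * int a ^ 6
         - 4 * int d ^ 7 * int a ^ 5 + int d ^ 8 * int a ^ 4)"
    by (rule sum.cong) (simp, algebra)
  also have "\<dots> = int d ^ 4 * (\<Sum>a=1..<d. int a ^ 8) - 4 * int d ^ 5 * (\<Sum>a=1..<d. int a ^ 7)
      + 6 * int d ^ 6 * (\<Sum>a=1..<d. int a ^ 6) - 4 * int d ^ 7 * (\<Sum>a=1..<d. int a ^ 5)
      + int d ^ 8 * (\<Sum>a=1..<d. int a ^ 4)"
    by (simp add: sum.distrib sum_subtractf sum_distrib_left)
  finally show ?thesis using power_sums[of d] by algebra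
qed

text \<open>
  The identity of \<open>reps_sum_symmetric\<close> for all \<open>n\<close> at once. If \<open>h d d = c d^(k+1)\<close>, then
  \<open>(n / d) h d d = c n d^k\<close>, and the factor \<open>n\<close> becomes the derivation \<open>q d/dq\<close>. The integer \<open>M\<close> clears the
  denominators of the power sums.
\<close>

lemma sigma_gf_convolution:
  fixes h :: "int \<Rightarrow> int \<Rightarrow> int" and f :: "int fps"
  assumes sym: "\<And>s t. h s t = h t s" and refl: "\<And>s t. h s t = h (t - s) t"
    and diag: "\<And>s. h s s = c * s ^ Suc k"
    and lhs: "\<And>n. (\<Sum>(a, b, x, y)\<in>reps n. h (int a) (int a + int b) - h (int a) (int b)) = fps_nth f n"
    and rhs: "\<And>d. M * (\<Sum>a=1..<d. h (int a) (int d)) = (\<Sum>(u, i)\<leftarrow>us. u * int d ^ i)"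
  shows "fps_const M * f = (\<Sum>(u, i)\<leftarrow>us. fps_const u * sigma_gf i)
    - fps_const (M * c) * (fps_XD (sigma_gf k) - sigma_gf (Suc k))"
proof (rule fps_ext)
  fix n
  have nth: "fps_nth (\<Sum>(u, i)\<leftarrow>us. fps_const u * sigma_gf i) n
      = (\<Sum>(u, i)\<leftarrow>us. u * fps_nth (sigma_gf i) n)"
    by (induction us) auto
  have swap: "(\<Sum>d | d dvd n. \<Sum>(u, i)\<leftarrow>us. u * int d ^ i) = (\<Sum>(u, i)\<leftarrow>us. u * (\<Sum>d | d dvd n. int d ^ i))"
    by (induction us) (auto simp: sum.distrib sum_distrib_left)
  show "fps_nth (fps_const M * f) n = fps_nth ((\<Sum>(u, i)\<leftarrow>us. fps_const u * sigma_gf i)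
    - fps_const (M * c) * (fps_XD (sigma_gf k) - sigma_gf (Suc k))) n"
  proof (cases "n = 0")
    case True
    have "reps 0 = {}" by (auto simp: reps_def)
    then have "fps_nth f 0 = 0" using lhs[of 0] by simp
    moreover have "(\<Sum>(u, i)\<leftarrow>us. u * fps_nth (sigma_gf i) 0) = 0"
      by (induction us) (auto simp: sigma_gf_def)
    ultimately show ?thesis using True nth by (simp add: sigma_gf_def)
  next
    case False
    then have "M * fps_nth f n = (\<Sum>d | d dvd n. M * (\<Sum>a=1..<d. h (int a) (int d))
        - M * ((int (n div d) - 1) * h (int d) (int d)))"
      unfolding lhs[symmetric] by (subst reps_sum_symmetric[OF sym refl])
        (auto simp: sum_distrib_left right_diff_distrib)
    also have "\<dots> = (\<Sum>d | d dvd n. (\<Sum>(u, i)\<leftarrow>us. u * int d ^ i)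
        - (M * c * (int n * int d ^ k - int d ^ Suc k)))"
    proof (rule sum.cong)
      fix d assume "d \<in> {d. d dvd n}"
      then have "int n = int (n div d) * int d" by (metis dvd_div_mult_self mem_Collect_eq of_nat_mult)
      then show "M * (\<Sum>a=1..<d. h (int a) (int d)) - M * ((int (n div d) - 1) * h (int d) (int d))
          = (\<Sum>(u, i)\<leftarrow>us. u * int d ^ i) - (M * c * (int n * int d ^ k - int d ^ Suc k))"
        using rhs[of d] by (simp add: diag algebra_simps)
    qed simp
    also have "\<dots> = (\<Sum>(u, i)\<leftarrow>us. u * (\<Sum>d | d dvd n. int d ^ i))
        - M * c * (int n * (\<Sum>d | d dvd n. int d ^ k) - (\<Sum>d | d dvd n. int d ^ Suc k))"
      by (simp add: sum_subtractf sum_distrib_left right_diff_distrib swap)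
    finally show ?thesis using False nth by (simp add: sigma_gf_def)
  qed
qed

text \<open>
  A form \<open>h\<close> of degree \<open>d\<close> relates products of Eisenstein series of total weight \<open>d + 2\<close>, because
  \<open>h a (a + b) - h a b\<close> is odd in each variable. For \<open>hex_disc\<close> and its square this difference involves a
  single product, \<open>E\<^sub>4^2\<close> and \<open>E\<^sub>6 E\<^sub>8\<close> respectively. Powers of \<open>hex_norm\<close> do not vanish on the diagonal, so
  they bring in the derivative of an Eisenstein series.
\<close>

lemma sigma_gf_mult_1_3: "240 * (sigma_gf 1 * sigma_gf 3) = - sigma_gf 1 + 10 * sigma_gf 3 + 21 * sigma_gf 5 - 30 * fps_XD (sigma_gf 3)"
proof -
  have "fps_const 30 * (8 * (sigma_gf 1 * sigma_gf 3))
      = (\<Sum>(u, i)\<leftarrow>[(- 1, 1), (10, 3), (- 30, 4), (21, 5)]. fps_const u * sigma_gf i)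
        - fps_const (30 * 1) * (fps_XD (sigma_gf 3) - sigma_gf (Suc 3))"
  proof (rule sigma_gf_convolution[where h = "\<lambda>s t. hex_norm s t ^ 2"])
    fix n
    have "(\<Sum>(a, b, x, y)\<in>reps n. hex_norm (int a) (int a + int b) ^ 2 - hex_norm (int a) (int b) ^ 2)
        = (\<Sum>(a, b, x, y)\<in>reps n. 4 * int a ^ 3 * int b ^ 1) + (\<Sum>(a, b, x, y)\<in>reps n. 4 * int a ^ 1 * int b ^ 3)"
      unfolding sum.distrib[symmetric] by (rule sum.cong) (auto, algebra)
    then show "(\<Sum>(a, b, x, y)\<in>reps n. hex_norm (int a) (int a + int b) ^ 2 - hex_norm (int a) (int b) ^ 2)
        = fps_nth (8 * (sigma_gf 1 * sigma_gf 3)) n"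
      unfolding reps_sum_const_monom by (simp add: mult.commute[of "sigma_gf 3" "sigma_gf (Suc 0)"] numeral_fps_const)
  qed (use sum_hex_norm_sq in \<open>simp_all add: algebra_simps power_numeral_reduce\<close>)
  then show ?thesis by (simp add: algebra_simps numeral_fps_const flip: fps_const_neg)
qed

lemma sigma_gf_mult_3_3: "120 * (sigma_gf 3 * sigma_gf 3) = sigma_gf 7 - sigma_gf 3"
proof -
  have "fps_const 30 * (4 * (sigma_gf 3 * sigma_gf 3))
      = (\<Sum>(u, i)\<leftarrow>[(- 1, 3), (1, 7)]. fps_const u * sigma_gf i)
        - fps_const (30 * 0) * (fps_XD (sigma_gf 0) - sigma_gf (Suc 0))"
  proof (rule sigma_gf_convolution[where h = "\<lambda>s t. hex_disc s t"])
    fix n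
    have "(\<Sum>(a, b, x, y)\<in>reps n. hex_disc (int a) (int a + int b) - hex_disc (int a) (int b))
        = (\<Sum>(a, b, x, y)\<in>reps n. 4 * int a ^ 3 * int b ^ 3)"
      unfolding sum.distrib[symmetric] by (rule sum.cong) (auto, algebra)
    then show "(\<Sum>(a, b, x, y)\<in>reps n. hex_disc (int a) (int a + int b) - hex_disc (int a) (int b))
        = fps_nth (4 * (sigma_gf 3 * sigma_gf 3)) n"
      unfolding reps_sum_const_monom by (simp add: numeral_fps_const)
  qed (use sum_hex_disc in \<open>simp_all add: algebra_simps power_numeral_reduce\<close>)
  then show ?thesis by (simp add: algebra_simps numeral_fps_const flip: fps_const_neg)
qed

lemma sigma_gf_mult_1_5: "5040 * (sigma_gf 1 * sigma_gf 5) + 5880 * (sigma_gf 3 * sigma_gf 3) = 10 * sigma_gf 1 - 49 * sigma_gf 3 + 210 * sigma_gf 5 + 249 * sigma_gf 7 - 420 * fps_XD (sigma_gf 5)"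
proof -
  have "fps_const 420 * (12 * (sigma_gf 1 * sigma_gf 5) + 14 * (sigma_gf 3 * sigma_gf 3))
      = (\<Sum>(u, i)\<leftarrow>[(10, 1), (- 49, 3), (210, 5), (- 420, 6), (249, 7)]. fps_const u * sigma_gf i)
        - fps_const (420 * 1) * (fps_XD (sigma_gf 5) - sigma_gf (Suc 5))"
  proof (rule sigma_gf_convolution[where h = "\<lambda>s t. hex_norm s t ^ 3"])
    fix n
    have "(\<Sum>(a, b, x, y)\<in>reps n. hex_norm (int a) (int a + int b) ^ 3 - hex_norm (int a) (int b) ^ 3)
        = (\<Sum>(a, b, x, y)\<in>reps n. 6 * int a ^ 5 * int b ^ 1) + (\<Sum>(a, b, x, y)\<in>reps n. 14 * int a ^ 3 * int b ^ 3) + (\<Sum>(a, b, x, y)\<in>reps n. 6 * int a ^ 1 * int b ^ 5)"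
      unfolding sum.distrib[symmetric] by (rule sum.cong) (auto, algebra)
    then show "(\<Sum>(a, b, x, y)\<in>reps n. hex_norm (int a) (int a + int b) ^ 3 - hex_norm (int a) (int b) ^ 3)
        = fps_nth (12 * (sigma_gf 1 * sigma_gf 5) + 14 * (sigma_gf 3 * sigma_gf 3)) n"
      unfolding reps_sum_const_monom by (simp add: mult.commute[of "sigma_gf 5" "sigma_gf (Suc 0)"] numeral_fps_const)
  qed (use sum_hex_norm_cube in \<open>simp_all add: algebra_simps power_numeral_reduce\<close>)
  then show ?thesis by (simp add: algebra_simps numeral_fps_const flip: fps_const_neg)
qed

lemma sigma_gf_mult_3_7: "10080 * (sigma_gf 3 * sigma_gf 7) + 12600 * (sigma_gf 5 * sigma_gf 5) = - 21 * sigma_gf 3 + 50 * sigma_gf 5 - 42 * sigma_gf 7 + 13 * sigma_gf 11"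
proof -
  have "fps_const 630 * (16 * (sigma_gf 3 * sigma_gf 7) + 20 * (sigma_gf 5 * sigma_gf 5))
      = (\<Sum>(u, i)\<leftarrow>[(- 21, 3), (50, 5), (- 42, 7), (13, 11)]. fps_const u * sigma_gf i)
        - fps_const (630 * 0) * (fps_XD (sigma_gf 0) - sigma_gf (Suc 0))"
  proof (rule sigma_gf_convolution[where h = "\<lambda>s t. hex_norm s t ^ 2 * hex_disc s t"])
    fix n
    have "(\<Sum>(a, b, x, y)\<in>reps n. hex_norm (int a) (int a + int b) ^ 2 * hex_disc (int a) (int a + int b) - hex_norm (int a) (int b) ^ 2 * hex_disc (int a) (int b))
        = (\<Sum>(a, b, x, y)\<in>reps n. 8 * int a ^ 7 * int b ^ 3) + (\<Sum>(a, b, x, y)\<in>reps n. 20 * int a ^ 5 * int b ^ 5) + (\<Sum>(a, b, x, y)\<in>reps n. 8 * int a ^ 3 * int b ^ 7)"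
      unfolding sum.distrib[symmetric] by (rule sum.cong) (auto, algebra)
    then show "(\<Sum>(a, b, x, y)\<in>reps n. hex_norm (int a) (int a + int b) ^ 2 * hex_disc (int a) (int a + int b) - hex_norm (int a) (int b) ^ 2 * hex_disc (int a) (int b))
        = fps_nth (16 * (sigma_gf 3 * sigma_gf 7) + 20 * (sigma_gf 5 * sigma_gf 5)) n"
      unfolding reps_sum_const_monom by (simp add: mult.commute[of "sigma_gf 7" "sigma_gf 3"] numeral_fps_const)
  qed (use sum_hex_norm_sq_disc in \<open>simp_all add: algebra_simps power_numeral_reduce\<close>)
  then show ?thesis by (simp add: algebra_simps numeral_fps_const flip: fps_const_neg)
qed

lemma sigma_gf_mult_5_7: "10080 * (sigma_gf 5 * sigma_gf 7) = - 21 * sigma_gf 5 + 20 * sigma_gf 7 + sigma_gf 13"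
proof -
  have "fps_const 630 * (16 * (sigma_gf 5 * sigma_gf 7))
      = (\<Sum>(u, i)\<leftarrow>[(- 21, 5), (20, 7), (1, 13)]. fps_const u * sigma_gf i)
        - fps_const (630 * 0) * (fps_XD (sigma_gf 0) - sigma_gf (Suc 0))"
  proof (rule sigma_gf_convolution[where h = "\<lambda>s t. hex_disc s t ^ 2"])
    fix n
    have "(\<Sum>(a, b, x, y)\<in>reps n. hex_disc (int a) (int a + int b) ^ 2 - hex_disc (int a) (int b) ^ 2)
        = (\<Sum>(a, b, x, y)\<in>reps n. 8 * int a ^ 7 * int b ^ 5) + (\<Sum>(a, b, x, y)\<in>reps n. 8 * int a ^ 5 * int b ^ 7)"
      unfolding sum.distrib[symmetric] by (rule sum.cong) (auto, algebra)
    then show "(\<Sum>(a, b, x, y)\<in>reps n. hex_disc (int a) (int a + int b) ^ 2 - hex_disc (int a) (int b) ^ 2)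
        = fps_nth (16 * (sigma_gf 5 * sigma_gf 7)) n"
      unfolding reps_sum_const_monom by (simp add: mult.commute[of "sigma_gf 7" "sigma_gf 5"] numeral_fps_const)
  qed (use sum_hex_disc_sq in \<open>simp_all add: algebra_simps power_numeral_reduce\<close>)
  then show ?thesis by (simp add: algebra_simps numeral_fps_const flip: fps_const_neg)
qed

text \<open>
  The Eisenstein series of weights 2, 4 and 6 with constant term 1.
\<close>

definition "ramanujan_P = 1 - 24 * sigma_gf 1"
definition "ramanujan_Q = 1 + 240 * sigma_gf 3"
definition "ramanujan_R = 1 - 504 * sigma_gf 5"

lemma XD_numeral_mult: "fps_XD (numeral w * f :: int fps) = numeral w * fps_XD f"
  by (simp add: numeral_fps_const)

lemma XD_ramanujan_Q: "3 * fps_XD ramanujan_Q = ramanujan_P * ramanujan_Q - ramanujan_R"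
proof -
  have "fps_XD ramanujan_Q = 240 * fps_XD (sigma_gf 3)"
    unfolding ramanujan_Q_def by (simp add: XD_numeral_mult fps_XD_def algebra_simps)
  then show ?thesis using sigma_gf_mult_1_3 unfolding ramanujan_P_def ramanujan_Q_def ramanujan_R_def by algebra
qed

lemma ramanujan_Q_sq: "ramanujan_Q\<^sup>2 = 1 + 480 * sigma_gf 7"
  using sigma_gf_mult_3_3 unfolding ramanujan_Q_def by algebra

lemma XD_ramanujan_R: "2 * fps_XD ramanujan_R = ramanujan_P * ramanujan_R - ramanujan_Q\<^sup>2"
proof -
  have "fps_XD ramanujan_R = - (504 * fps_XD (sigma_gf 5))"
    unfolding ramanujan_R_def by (simp add: XD_numeral_mult fps_XD_def algebra_simps)
  \<comment> \<open>The product of the two divisor series occurs in \<open>P R\<close> with coefficient \<open>24 * 504\<close>, which is \<open>12 / 5\<close> of 5040.\<close>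
  then have "5 * (2 * fps_XD ramanujan_R) = 5 * (ramanujan_P * ramanujan_R - ramanujan_Q\<^sup>2)"
    using sigma_gf_mult_1_5 sigma_gf_mult_3_3 unfolding ramanujan_P_def ramanujan_R_def ramanujan_Q_def by algebra
  then show ?thesis by (simp only: mult_cancel_left) simp
qed

text \<open>
  In \<open>sigma_gf_mult_3_7\<close> the products \<open>E\<^sub>4 E\<^sub>8\<close> and \<open>E\<^sub>6^2\<close> occur in exactly the proportion that expresses
  the Eisenstein series of weight 12 by \<open>Q\<close> and \<open>R\<close>. Because 13 divides 65520, the right-hand side is
  constant modulo 13.
\<close>

lemma eisenstein_12: "441 * ramanujan_Q ^ 3 + 250 * ramanujan_R\<^sup>2 = 691 + 65520 * sigma_gf 11"
proof -
  have "ramanujan_Q ^ 3 = (1 + 240 * sigma_gf 3) * (1 + 480 * sigma_gf 7)"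
    using ramanujan_Q_sq unfolding power3_eq_cube power2_eq_square by (metis ramanujan_Q_def mult.commute)
  then show ?thesis using sigma_gf_mult_3_7 unfolding ramanujan_R_def by algebra
qed

text \<open>
  Modulo 13 the right-hand side is \<open>P\<close>, by Fermat's little theorem.
\<close>

lemma eisenstein_14: "ramanujan_Q\<^sup>2 * ramanujan_R = 1 - 24 * sigma_gf 13"
  using sigma_gf_mult_5_7 unfolding ramanujan_Q_sq ramanujan_R_def by algebra

section \<open>The partition series and the discriminant\<close>

lemma XD_mult: "fps_XD (f * g) = fps_XD f * g + f * fps_XD (g :: 'a :: comm_ring_1 fps)"
  by (simp add: fps_XD_def algebra_simps)

lemma XD_diff: "fps_XD (f - g) = fps_XD f - fps_XD (g :: 'a :: comm_ring_1 fps)"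
  by (simp add: fps_XD_def algebra_simps)

lemma XD_power: "fps_XD (f ^ n) = of_nat n * f ^ (n - 1) * fps_XD (f :: 'a :: comm_ring_1 fps)"
  by (simp add: fps_XD_def fps_deriv_power fps_of_nat mult_ac)

lemma XD_X_power: "fps_XD (fps_X ^ n) = of_nat n * (fps_X ^ n :: 'a :: comm_ring_1 fps)"
  by (rule fps_ext) (simp add: fps_X_power_nth flip: fps_of_nat)

definition partition_series :: "int fps" where
  "partition_series = (\<Prod>n. frob_factor 1 (Suc n))"

text \<open>
  Euler's product of the factors \<open>1 - q^n\<close>. Defining it as an inverse avoids a second discussion of
  convergence.
\<close>

definition euler_series :: "int fps" where
  "euler_series = fps_right_inverse partition_series 1"

lemma geometric_factor_nth:
  assumes "i > 0"
  shows "fps_nth (frob_factor 1 i) n = (if i dvd n then 1 else 0)"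
proof -
  define g :: "int fps" where "g = Abs_fps (\<lambda>n. if i dvd n then 1 else 0)"
  have "(1 - fps_X ^ i) * g = 1"
  proof (rule fps_ext)
    fix n
    have "(1 - fps_X ^ i) * g = g - fps_X ^ i * g" by (simp add: algebra_simps)
    then have "fps_nth ((1 - fps_X ^ i) * g) n = fps_nth g n - (if n < i then 0 else fps_nth g (n - i))"
      by (simp add: fps_X_power_mult_nth)
    also have "\<dots> = fps_nth 1 n"
      using assms by (auto simp: g_def dvd_minus_self dest: dvd_imp_le)
    finally show "fps_nth ((1 - fps_X ^ i) * g) n = fps_nth 1 n" .
  qed
  moreover have "(1 - fps_X ^ i) * frob_factor 1 i = 1"
    using frob_factor_correct[OF assms, of 1] by simp
  moreover have "((1 - fps_X ^ i) * g) * frob_factor 1 i = ((1 - fps_X ^ i) * frob_factor 1 i) * g"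
    by (simp only: mult_ac)
  ultimately have "frob_factor 1 i = g" by simp
  then show ?thesis by (simp add: g_def)
qed

lemma XD_geometric_factor:
  assumes "i > 0"
  shows "fps_XD (frob_factor 1 i) = frob_factor 1 i * (of_nat i * fps_X ^ i * frob_factor 1 i)"
proof -
  let ?f = "frob_factor 1 i" and ?u = "fps_X ^ i :: int fps"
  have inv: "(1 - ?u) * ?f = 1"
    using frob_factor_correct[OF assms, of 1] by simp
  have "fps_XD ((1 - ?u) * ?f) = 0" unfolding inv by (simp add: fps_XD_def)
  moreover have "fps_XD (1 - ?u) = - (of_nat i * ?u)"
    using XD_X_power[of i] by (simp add: fps_XD_def algebra_simps)
  ultimately have "(1 - ?u) * fps_XD ?f = of_nat i * ?u * ?f"
    unfolding XD_mult by (simp add: algebra_simps)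
  then have "((1 - ?u) * ?f) * fps_XD ?f = ?f * (of_nat i * ?u * ?f)" by (simp only: mult_ac)
  then show ?thesis unfolding inv by simp
qed

lemma partition_series_nth_0: "fps_nth partition_series 0 = 1"
  using frob_factor_prod_nth[of 0 0 1] geometric_factor_nth[of 1 0]
  by (simp add: partition_series_def)

text \<open>
  The logarithmic derivative of \<open>1 / (1 - q^i)\<close> is \<open>i q^i / (1 - q^i)\<close>, and these sum to the generating
  function of the divisor sums. A fixed coefficient only sees a finite part of the product.
\<close>

lemma XD_partition_series: "fps_XD partition_series = partition_series * sigma_gf 1"
proof (rule fps_ext)
  fix m
  define F where "F N = (\<Prod>i\<le>N. frob_factor 1 (Suc i))" for N
  define L :: "nat \<Rightarrow> int fps" where "L N = (\<Sum>i\<le>N. of_nat (Suc i) * fps_X ^ Suc i * frob_factor 1 (Suc i))" for N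
  have log_deriv: "fps_XD (F N) = F N * L N" for N
  proof (induction N)
    case 0
    show ?case using XD_geometric_factor[of 1] by (simp add: F_def L_def)
  next
    case (Suc N)
    have "F (Suc N) = F N * frob_factor 1 (Suc (Suc N))"
      and "L (Suc N) = L N + of_nat (Suc (Suc N)) * fps_X ^ Suc (Suc N) * frob_factor 1 (Suc (Suc N))"
      by (simp_all add: F_def L_def)
    then show ?case
      by (simp only: XD_mult Suc XD_geometric_factor[OF zero_less_Suc] ring_distribs mult_ac)
  qed
  have L_nth: "fps_nth (L m) n = fps_nth (sigma_gf 1) n" if "n \<le> m" for n
  proof (cases "n = 0")
    case True
    then show ?thesis by (simp add: L_def fps_sum_nth sigma_gf_def)
  next
    case False
    have "fps_nth (L m) n = (\<Sum>i\<le>m. if Suc i dvd n then int (Suc i) else 0)"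
    proof -
      have "fps_nth (of_nat (Suc i) * fps_X ^ Suc i * frob_factor 1 (Suc i)) n
          = (if Suc i dvd n then int (Suc i) else 0)" for i
        using False dvd_imp_le[of "Suc i" n] dvd_minus_self[of "Suc i" n]
        by (simp only: mult.assoc fps_of_nat[symmetric] fps_mult_left_const_nth fps_X_power_mult_nth
            geometric_factor_nth zero_less_Suc) auto
      then show ?thesis by (simp add: L_def fps_sum_nth)
    qed
    also have "\<dots> = (\<Sum>i\<in>{i. i \<le> m \<and> Suc i dvd n}. int (Suc i))"
      by (rule sum.mono_neutral_cong_right) auto
    also have "\<dots> = (\<Sum>d | d dvd n. int d)"
      by (rule sum.reindex_bij_witness[where i = "\<lambda>d. d - 1" and j = Suc])
         (use False \<open>n \<le> m\<close> in \<open>auto dest: dvd_imp_le intro: dvd_pos_nat\<close>)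
    finally show ?thesis using False by (simp add: sigma_gf_def)
  qed
  have F_nth: "fps_nth (F m) n = fps_nth partition_series n" if "n \<le> m" for n
    using frob_factor_prod_nth[OF that, of 1] by (simp add: F_def partition_series_def)
  have "fps_nth (fps_XD partition_series) m = fps_nth (fps_XD (F m)) m"
    by (simp add: F_nth)
  also have "\<dots> = (\<Sum>k=0..m. fps_nth (F m) k * fps_nth (L m) (m - k))"
    by (simp add: log_deriv fps_mult_nth)
  also have "\<dots> = fps_nth (partition_series * sigma_gf 1) m"
    by (simp add: fps_mult_nth F_nth L_nth)
  finally show "fps_nth (fps_XD partition_series) m = fps_nth (partition_series * sigma_gf 1) m" .
qed

lemma partition_euler: "partition_series * euler_series = 1"
  unfolding euler_series_def by (rule fps_right_inverse) (simp add: partition_series_nth_0)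

lemma XD_euler_series: "fps_XD euler_series = - (euler_series * sigma_gf 1)"
proof -
  let ?F = partition_series and ?E = euler_series
  have "fps_XD (?F * ?E) = 0" unfolding partition_euler by (simp add: fps_XD_def)
  then have "?F * sigma_gf 1 * ?E + ?F * fps_XD ?E = 0" by (simp add: XD_mult XD_partition_series)
  moreover have "(?F * ?E) * (?E * sigma_gf 1 + fps_XD ?E) = ?E * (?F * sigma_gf 1 * ?E + ?F * fps_XD ?E)"
    by (simp add: algebra_simps)
  ultimately have "(?F * ?E) * (?E * sigma_gf 1 + fps_XD ?E) = 0" by simp
  then show ?thesis unfolding partition_euler by (simp add: eq_neg_iff_add_eq_0 add.commute)
qed

lemma euler_series_nth_0: "fps_nth euler_series 0 = 1"
  using arg_cong[OF partition_euler, of "\<lambda>f. fps_nth f 0"] by (simp add: partition_series_nth_0)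

text \<open>
  Comparing coefficients of \<open>q^n\<close> gives \<open>(n - 1) f\<^sub>n\<close> in terms of earlier coefficients, so that a solution
  is determined by its first two coefficients. In characteristic 13 this fails at \<open>n = 14\<close>, which is why the
  discriminant formula is derived over the integers.
\<close>

lemma XD_eigen_unique:
  fixes f g p :: "int fps"
  assumes "fps_XD f = p * f" "fps_XD g = p * g" "fps_nth p 0 = 1"
    and "fps_nth f 0 = fps_nth g 0" "fps_nth f 1 = fps_nth g 1"
  shows "f = g"
proof -
  define d where "d = f - g"
  have ode: "fps_XD d = p * d" using assms by (simp add: d_def fps_XD_def algebra_simps)
  have "fps_nth d n = 0" for n
  proof (induction n rule: less_induct)
    case (less n)
    show ?case
    proof (cases "n < 2")
      case True
      then have "n = 0 \<or> n = 1" by auto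
      then show ?thesis using assms by (auto simp: d_def)
    next
      case False
      have "int n * fps_nth d n = fps_nth (d * p) n"
        using arg_cong[OF ode, of "\<lambda>f. fps_nth f n"] by (simp add: mult.commute)
      also have "\<dots> = (\<Sum>k=0..n. if k = n then fps_nth d n else 0)"
        unfolding fps_mult_nth using less assms(3) by (intro sum.cong) auto
      also have "\<dots> = fps_nth d n" by simp
      finally have "(int n - 1) * fps_nth d n = 0" by (simp add: algebra_simps)
      then show ?thesis using False by auto
    qed
  qed
  then have "d = 0" by (simp add: fps_eq_iff)
  then show ?thesis by (simp add: d_def)
qed

text \<open>
  By Ramanujan's differential equations, both sides are solutions of \<open>q df/dq = P f\<close>.
\<close>

lemma discriminant: "ramanujan_Q ^ 3 - ramanujan_R\<^sup>2 = 1728 * (fps_X * euler_series ^ 24)"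
proof (rule XD_eigen_unique)
  have "fps_XD (ramanujan_Q ^ 3 - ramanujan_R\<^sup>2) = 3 * ramanujan_Q\<^sup>2 * fps_XD ramanujan_Q - 2 * ramanujan_R * fps_XD ramanujan_R"
    by (simp add: XD_diff XD_power)
  then show "fps_XD (ramanujan_Q ^ 3 - ramanujan_R\<^sup>2) = ramanujan_P * (ramanujan_Q ^ 3 - ramanujan_R\<^sup>2)"
    using XD_ramanujan_Q XD_ramanujan_R by algebra
  have X: "fps_XD (fps_X :: int fps) = fps_X" using XD_X_power[of 1, where 'a = int] by simp
  have "fps_XD (fps_X * euler_series ^ 24)
      = fps_X * euler_series ^ 24 + fps_X * (24 * euler_series ^ 23 * fps_XD euler_series)"
    using X XD_power[of euler_series 24] by (simp add: XD_mult)
  also have "\<dots> = ramanujan_P * (fps_X * euler_series ^ 24)"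
    unfolding XD_euler_series ramanujan_P_def by algebra
  finally show "fps_XD (1728 * (fps_X * euler_series ^ 24)) = ramanujan_P * (1728 * (fps_X * euler_series ^ 24))"
    unfolding XD_numeral_mult by algebra
  have S: "fps_nth (sigma_gf k) 0 = 0" "fps_nth (sigma_gf k) 1 = 1" for k
    by (simp_all add: sigma_gf_def)
  show "fps_nth ramanujan_P 0 = 1" by (simp add: ramanujan_P_def S)
  have Q01: "fps_nth ramanujan_Q 0 = 1" "fps_nth ramanujan_Q 1 = 240" and R01: "fps_nth ramanujan_R 0 = 1" "fps_nth ramanujan_R 1 = - 504"
    using S[of 3] S[of 5] by (simp_all add: ramanujan_Q_def ramanujan_R_def numeral_fps_const)
  have E0: "fps_nth (euler_series ^ 24) 0 = 1"
    by (simp add: fps_nth_power_0 euler_series_nth_0)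
  show "fps_nth (ramanujan_Q ^ 3 - ramanujan_R\<^sup>2) 0 = fps_nth (1728 * (fps_X * euler_series ^ 24)) 0"
    by (simp add: Q01 R01 fps_nth_power_0)
  have "fps_nth (1728 * (fps_X * euler_series ^ 24)) 1 = 1728"
    unfolding numeral_fps_const fps_mult_left_const_nth by (simp add: E0)
  moreover have "fps_nth (ramanujan_Q ^ 3 - ramanujan_R\<^sup>2) 1 = 1728"
    using Q01 R01 by (simp add: power3_eq_cube power2_eq_square fps_mult_nth_1)
  ultimately show "fps_nth (ramanujan_Q ^ 3 - ramanujan_R\<^sup>2) 1 = fps_nth (1728 * (fps_X * euler_series ^ 24)) 1"
    by simp
qed

section \<open>Power series modulo 13 and their sections\<close>

lemma of_nat_13_eq_0: "of_nat n = (0 :: 13) \<longleftrightarrow> 13 dvd n"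
  by (simp add: of_nat_eq_0_iff_char_dvd)

lemma freshmans_dream_13: "(a + b) ^ 13 = a ^ 13 + (b :: 13) ^ 13"
  by (rule freshmans_dream) simp_all

lemma power_13: "(c :: 13) ^ 13 = c"
proof -
  have "(of_nat n :: 13) ^ 13 = of_nat n" for n
    by (induction n) (simp_all add: freshmans_dream_13)
  moreover obtain n where "c = of_nat n"
  proof (cases c)
    case (of_int z)
    then show ?thesis using that[of "nat z"] by simp
  qed
  ultimately show ?thesis by simp
qed

lemma of_nat_13_power:
  assumes "\<not> 13 dvd n"
  shows "(of_nat n :: 13) ^ 12 = 1"
proof -
  have "coprime n 13" using prime_imp_coprime[of 13 n] assms by (simp add: coprime_commute)
  then obtain u where "[n * u = 1] (mod 13)" using cong_solve_coprime_nat by auto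
  then have u: "(of_nat n * of_nat u :: 13) = 1"
    using of_nat_eq_iff_cong_CHAR[of "n * u" 1, where 'a = 13] by simp
  have "(of_nat n :: 13) ^ 12 = of_nat n ^ 12 * (of_nat n * of_nat u)" by (simp add: u)
  also have "\<dots> = (of_nat n * of_nat n ^ 12) * of_nat u" by (simp only: mult_ac)
  also have "of_nat n * of_nat n ^ 12 = (of_nat n :: 13) ^ 13" by (simp flip: power_Suc)
  also have "\<dots> * of_nat u = 1" by (simp add: power_13 u)
  finally show ?thesis .
qed

lemma numeral_13_fps: "numeral v = (numeral w :: 13) \<Longrightarrow> numeral v = (numeral w :: 13 fps)"
  by (simp add: numeral_fps_const)

lemma numeral_13_fps_1: "numeral v = (1 :: 13) \<Longrightarrow> numeral v = (1 :: 13 fps)"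
  by (metis fps_const_1_eq_1 numeral_fps_const)

lemma numeral_13_fps_0: "numeral v = (0 :: 13) \<Longrightarrow> numeral v = (0 :: 13 fps)"
  by (metis fps_const_0_eq_0 numeral_fps_const)

lemma thirteen_eq_0: "(13 :: 13 fps) = 0"
  by (simp add: numeral_13_fps_0)

text \<open>
  In characteristic 13, raising to the 13th power is a ring homomorphism and fixes the coefficients;
  so \<open>f^13\<close> is \<open>f(q^13)\<close>.
\<close>

lemma power_13_nth:
  "fps_nth ((f :: 13 fps) ^ 13) n = (if 13 dvd n then fps_nth f (n div 13) else 0)"
proof -
  define g where "g = (\<Sum>i\<le>n. fps_const (fps_nth f i) * fps_X ^ i)"
  have dream: "(a + b) ^ 13 = a ^ 13 + b ^ 13" for a b :: "13 fps"
    by (rule freshmans_dream) simp_all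
  have "f = g + fps_X ^ Suc n * fps_shift (Suc n) f"
    by (rule fps_ext) (auto simp: g_def fps_sum_nth fps_X_power_nth fps_X_power_mult_nth if_distrib
        simp del: power_Suc cong: if_cong)
  then have "f ^ 13 = g ^ 13 + (fps_X ^ Suc n * fps_shift (Suc n) f) ^ 13"
    by (metis dream)
  also have "(fps_X ^ Suc n * fps_shift (Suc n) f) ^ 13 = fps_X ^ (13 * Suc n) * fps_shift (Suc n) f ^ 13"
    by (simp only: power_mult_distrib power_mult[symmetric] mult.commute[of 13])
  finally have "fps_nth (f ^ 13) n = fps_nth (g ^ 13) n"
    by (simp add: fps_X_power_mult_nth)
  also have "g ^ 13 = (\<Sum>i\<le>n. fps_const (fps_nth f i) * fps_X ^ (13 * i))"
    unfolding g_def by (subst freshmans_dream_sum)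
      (simp_all add: power_mult_distrib fps_const_power power_13 mult.commute flip: power_mult)
  also have "fps_nth \<dots> n = (\<Sum>i\<le>n. if i = n div 13 \<and> 13 dvd n then fps_nth f i else 0)"
    by (auto simp: fps_sum_nth fps_X_power_nth intro!: sum.cong)
  also have "\<dots> = (if 13 dvd n then fps_nth f (n div 13) else 0)"
    by auto
  finally show ?thesis .
qed

lemma power_13_inject: "(f :: 13 fps) ^ 13 = g ^ 13 \<Longrightarrow> f = g"
  using power_13_nth[of _ "13 * n" for n] by (intro fps_ext) (metis dvd_triv_left nonzero_mult_div_cancel_left zero_neq_numeral)

text \<open>
  Up to a power of \<open>q\<close>, this is the operator \<open>U\<^sub>1\<^sub>3\<close> applied to \<open>q^(13-j) f\<close>.
\<close>

definition section13 :: "nat \<Rightarrow> 13 fps \<Rightarrow> 13 fps" where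
  "section13 j f = Abs_fps (\<lambda>n. fps_nth f (13 * n + j))"

lemma section13_mult_power:
  assumes "j < 13"
  shows "section13 j (f * g ^ 13) = section13 j f * g"
proof (rule fps_ext)
  fix n
  let ?t = "\<lambda>i. fps_nth (g ^ 13) i * fps_nth f (13 * n + j - i)"
  have "fps_nth (section13 j (f * g ^ 13)) n = (\<Sum>i=0..13 * n + j. ?t i)"
    by (simp add: section13_def mult.commute[of f] fps_mult_nth)
  also have "\<dots> = (\<Sum>i\<in>{i. i \<le> 13 * n + j \<and> 13 dvd i}. ?t i)"
    by (rule sum.mono_neutral_right) (auto simp: power_13_nth)
  also have "\<dots> = (\<Sum>m=0..n. fps_nth g m * fps_nth f (13 * (n - m) + j))"
    by (rule sum.reindex_bij_witness[where j = "\<lambda>i. i div 13" and i = "\<lambda>m. 13 * m"])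
       (use assms in \<open>auto simp: power_13_nth algebra_simps elim!: dvdE\<close>)
  also have "\<dots> = fps_nth (g * section13 j f) n"
    by (simp add: fps_mult_nth section13_def)
  also have "\<dots> = fps_nth (section13 j f * g) n"
    by (simp only: mult.commute)
  finally show "fps_nth (section13 j (f * g ^ 13)) n = fps_nth (section13 j f * g) n" .
qed

lemma XDp_funpow_nth: "fps_nth ((fps_XDp c ^^ k) f) n = (c + of_nat n) ^ k * fps_nth f n"
  by (induction k) (simp_all add: mult_ac)

text \<open>
  The operator \<open>fps_XDp c\<close> multiplies the coefficient of \<open>q^n\<close> by \<open>c + n\<close>. For \<open>c = 13 - j\<close> its 12th power
  therefore kills the coefficients with \<open>n \<equiv> j\<close> modulo 13 and fixes all others. This turns the
  extraction of an arithmetic progression into a differential operator.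
\<close>

lemma section13_fermat:
  assumes "j < 13"
  shows "f - (fps_XDp (of_nat (13 - j)) ^^ 12) f = fps_X ^ j * section13 j f ^ 13"
proof (rule fps_ext)
  fix n
  have c: "of_nat (13 - j) + of_nat n = (of_nat (13 - j + n) :: 13)" by simp
  have dvd: "13 dvd 13 - j + n \<longleftrightarrow> j \<le> n \<and> 13 dvd n - j"
  proof (cases "j \<le> n")
    case True
    then have "13 - j + n = 13 + (n - j)" using assms by simp
    then show ?thesis using True by (metis dvd_add_right_iff dvd_refl)
  next
    case False
    then have "0 < 13 - j + n" "13 - j + n < 13" using assms by auto
    then show ?thesis using False by (auto dest: dvd_imp_le)
  qed
  have "fps_nth (f - (fps_XDp (of_nat (13 - j)) ^^ 12) f) n
      = fps_nth f n - (of_nat (13 - j + n)) ^ 12 * fps_nth f n"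
    by (simp only: XDp_funpow_nth fps_sub_nth c)
  also have "\<dots> = (if 13 dvd 13 - j + n then fps_nth f n else 0)"
    using of_nat_13_eq_0[of "13 - j + n"] of_nat_13_power[of "13 - j + n"] by (auto simp del: of_nat_add)
  also have "\<dots> = fps_nth (fps_X ^ j * section13 j f ^ 13) n"
    unfolding dvd by (auto simp: fps_X_power_mult_nth power_13_nth section13_def)
  finally show "fps_nth (f - (fps_XDp (of_nat (13 - j)) ^^ 12) f) n = fps_nth (fps_X ^ j * section13 j f ^ 13) n" .
qed

definition reduce :: "int fps \<Rightarrow> 13 fps" where
  "reduce f = Abs_fps (\<lambda>n. of_int (fps_nth f n))"

lemma reduce_nth: "fps_nth (reduce f) n = of_int (fps_nth f n)"
  by (simp add: reduce_def)

lemma reduce_hom: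
  "reduce 0 = 0" "reduce 1 = 1" "reduce (- f) = - reduce f"
  "reduce (f + g) = reduce f + reduce g" "reduce (f - g) = reduce f - reduce g"
  "reduce (f * g) = reduce f * reduce g" "reduce (f ^ m) = reduce f ^ m"
  "reduce (numeral w) = numeral w" "reduce fps_X = fps_X" "reduce (fps_XD f) = fps_XD (reduce f)"
proof -
  show 1: "reduce 1 = 1" by (rule fps_ext) (simp add: reduce_def)
  show mult: "reduce (f * g) = reduce f * reduce g" for f g
    by (rule fps_ext) (simp add: reduce_def fps_mult_nth)
  show "reduce (f ^ m) = reduce f ^ m" by (induction m) (simp_all add: 1 mult)
  show "reduce (numeral w) = numeral w"
    by (rule fps_ext) (simp add: reduce_def numeral_fps_const fps_const_def)
qed (rule fps_ext; simp add: reduce_def fps_X_def)+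

section \<open>Sections of powers of the Euler product modulo 13\<close>

definition "Q_mod13 = reduce ramanujan_Q"
definition "R_mod13 = reduce ramanujan_R"
definition "euler13 = reduce euler_series"

lemma P_mod13: "reduce ramanujan_P = Q_mod13\<^sup>2 * R_mod13"
proof -
  have "reduce (sigma_gf 13) = reduce (sigma_gf 1)"
    by (rule fps_ext) (simp add: reduce_def sigma_gf_def power_13)
  then have "reduce (1 - 24 * sigma_gf 13) = reduce ramanujan_P"
    by (simp add: ramanujan_P_def reduce_hom)
  then show ?thesis
    unfolding eisenstein_14[symmetric] by (simp add: reduce_hom Q_mod13_def R_mod13_def)
qed

text \<open>
  The reduction of \<open>eisenstein_12\<close>: the Eisenstein series of weight 12 is constant modulo 13. (This is the
  statement that the Hasse invariant has \<open>q\<close>-expansion 1.)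
\<close>

lemma R_mod13_sq: "R_mod13\<^sup>2 = 9 * Q_mod13 ^ 3 + 5"
proof -
  have "reduce (441 * ramanujan_Q ^ 3 + 250 * ramanujan_R\<^sup>2) = reduce (691 + 65520 * sigma_gf 11)"
    unfolding eisenstein_12 ..
  then have "441 * Q_mod13 ^ 3 + 250 * R_mod13\<^sup>2 = 691 + 65520 * reduce (sigma_gf 11)"
    by (simp add: reduce_hom Q_mod13_def R_mod13_def)
  moreover have "(441 :: 13 fps) = 12" "(250 :: 13 fps) = 3" "(691 :: 13 fps) = 2"
    "(65520 :: 13 fps) = 0"
    by (simp_all add: numeral_13_fps numeral_13_fps_0)
  ultimately have "9 * (12 * Q_mod13 ^ 3 + 3 * R_mod13\<^sup>2) = 9 * 2" by simp
  then have "108 * Q_mod13 ^ 3 + 27 * R_mod13\<^sup>2 = 18" by (simp add: algebra_simps)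
  moreover have "(108 :: 13 fps) = 4" "(27 :: 13 fps) = 1" "(18 :: 13 fps) = 5"
    by (simp_all add: numeral_13_fps numeral_13_fps_1)
  ultimately have "R_mod13\<^sup>2 = 5 - 4 * Q_mod13 ^ 3" by (simp add: algebra_simps)
  moreover have "9 * Q_mod13 ^ 3 + 4 * Q_mod13 ^ 3 = 13 * Q_mod13 ^ 3" by simp
  then have "9 * Q_mod13 ^ 3 = - (4 * Q_mod13 ^ 3)"
    by (simp add: thirteen_eq_0 eq_neg_iff_add_eq_0)
  ultimately show ?thesis by simp
qed

lemma XD_Q_mod13: "fps_XD Q_mod13 = 9 * R_mod13 * (Q_mod13 ^ 3 - 1)"
proof -
  have "3 * fps_XD Q_mod13 = reduce (3 * fps_XD ramanujan_Q)" by (simp add: reduce_hom Q_mod13_def)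
  also have "\<dots> = R_mod13 * (Q_mod13 ^ 3 - 1)"
    unfolding XD_ramanujan_Q by (simp add: reduce_hom P_mod13 algebra_simps power2_eq_square power3_eq_cube flip: Q_mod13_def R_mod13_def)
  \<comment> \<open>9 is the inverse of 3.\<close>
  finally have "9 * (3 * fps_XD Q_mod13) = 9 * (R_mod13 * (Q_mod13 ^ 3 - 1))" by simp
  then have "27 * fps_XD Q_mod13 = 9 * R_mod13 * (Q_mod13 ^ 3 - 1)" by (simp only: mult.assoc[symmetric]) simp
  moreover have "(27 :: 13 fps) = 1" by (simp add: numeral_13_fps_1)
  ultimately show ?thesis by simp
qed

lemma XD_R_mod13: "fps_XD R_mod13 = 11 * Q_mod13\<^sup>2 * (Q_mod13 ^ 3 - 1)"
proof -
  have "2 * fps_XD R_mod13 = reduce (2 * fps_XD ramanujan_R)" by (simp add: reduce_hom R_mod13_def)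
  also have "\<dots> = Q_mod13\<^sup>2 * (R_mod13\<^sup>2 - 1)"
    unfolding XD_ramanujan_R by (simp add: reduce_hom P_mod13 algebra_simps power2_eq_square flip: Q_mod13_def R_mod13_def)
  also have "\<dots> = Q_mod13\<^sup>2 * (9 * Q_mod13 ^ 3 + 4)" unfolding R_mod13_sq by (simp add: add.commute)
  finally have "7 * (2 * fps_XD R_mod13) = 7 * (Q_mod13\<^sup>2 * (9 * Q_mod13 ^ 3 + 4))" by simp
  then have "14 * fps_XD R_mod13 = Q_mod13\<^sup>2 * (63 * Q_mod13 ^ 3 + 28)" by (simp add: algebra_simps)
  moreover have "(14 :: 13 fps) = 1" by (simp add: numeral_13_fps_1)
  moreover have "(63 :: 13 fps) = 11" "(28 :: 13 fps) = 2" by (simp_all add: numeral_13_fps)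
  moreover have "11 * Q_mod13\<^sup>2 * (Q_mod13 ^ 3 - 1) = Q_mod13\<^sup>2 * (11 * Q_mod13 ^ 3 + 2) - 13 * Q_mod13\<^sup>2"
    by (simp add: algebra_simps)
  ultimately show ?thesis by (simp add: thirteen_eq_0)
qed

lemma delta13: "fps_X * euler13 ^ 24 = 8 * Q_mod13 ^ 3 - 8"
proof -
  have "1728 * (fps_X * euler13 ^ 24) = reduce (1728 * (fps_X * euler_series ^ 24))"
    by (simp add: reduce_hom euler13_def)
  also have "\<dots> = Q_mod13 ^ 3 - R_mod13\<^sup>2"
    unfolding discriminant[symmetric] by (simp add: reduce_hom Q_mod13_def R_mod13_def)
  also have "\<dots> = - 8 * Q_mod13 ^ 3 - 5" unfolding R_mod13_sq by simp
  finally have "1728 * (fps_X * euler13 ^ 24) = - 8 * Q_mod13 ^ 3 - 5" .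
  moreover have "(1728 :: 13 fps) = 12" by (simp add: numeral_13_fps)
  ultimately have "12 * (fps_X * euler13 ^ 24) = - 8 * Q_mod13 ^ 3 - 5" by simp
  moreover have "fps_X * euler13 ^ 24 = 13 * (fps_X * euler13 ^ 24) - 12 * (fps_X * euler13 ^ 24)" by simp
  moreover have "8 * Q_mod13 ^ 3 - 8 = 8 * Q_mod13 ^ 3 + 5 - (13 :: 13 fps)" by simp
  ultimately show ?thesis by (simp add: thirteen_eq_0)
qed

text \<open>
  Conjugating by \<open>E^k\<close> turns \<open>q d/dq + k/24\<close> into \<open>q d/dq + (k/24) P\<close>. Modulo 13 the inverse of 24 is 6,
  and \<open>q d/dq\<close> of \<open>E^k\<close> is \<open>- k \<Sigma>\<sigma>(n) q^n\<close> times \<open>E^k\<close>, where \<open>P = 1 - 24 \<Sigma>\<sigma>(n) q^n\<close>.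
\<close>

lemma XDp_euler13_power:
  assumes "of_nat (6 * k) = c"
  shows "fps_XDp c (euler13 ^ k * u) = euler13 ^ k * (fps_XD u + fps_const c * (Q_mod13\<^sup>2 * R_mod13) * u)"
proof -
  have XDe: "fps_XD euler13 = - (euler13 * reduce (sigma_gf 1))"
    unfolding euler13_def reduce_hom(10)[symmetric] XD_euler_series by (simp add: reduce_hom)
  have "fps_XD (euler13 ^ k) = - (of_nat k * euler13 ^ k * reduce (sigma_gf 1))"
    unfolding XD_power XDe by (cases k) (simp_all add: mult_ac)
  moreover have "fps_const c * (Q_mod13\<^sup>2 * R_mod13) = fps_const c - of_nat k * reduce (sigma_gf 1)"
  proof -
    have c: "fps_const c = of_nat k * 6"
      unfolding assms[symmetric] fps_of_nat by simp
    have "of_nat k * 6 * (Q_mod13\<^sup>2 * R_mod13) = of_nat k * 6 - of_nat k * (144 * reduce (sigma_gf 1))"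
      unfolding P_mod13[symmetric] ramanujan_P_def by (simp add: reduce_hom algebra_simps)
    moreover have "(144 :: 13 fps) = 1" by (simp add: numeral_13_fps_1)
    ultimately show ?thesis unfolding c by simp
  qed
  ultimately show ?thesis
    unfolding fps_XDp_def XD_mult by (simp only:) (simp add: algebra_simps)
qed

text \<open>
  Polynomials keep integer coefficients until they are evaluated: the formal derivative \<open>pderiv\<close> is available
  for them, and congruences modulo 13 become divisibility of numerals.
\<close>

definition eval_q :: "int poly \<Rightarrow> 13 fps" where
  "eval_q g = poly (map_poly of_int g) Q_mod13"

lemma eval_q_hom:
  "eval_q 0 = 0" "eval_q 1 = 1" "eval_q (pCons c g) = of_int c + Q_mod13 * eval_q g"
  "eval_q (g + h) = eval_q g + eval_q h" "eval_q (- g) = - eval_q g" "eval_q (g - h) = eval_q g - eval_q h"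
  "eval_q (smult c g) = of_int c * eval_q g"
  "eval_q (g * h) = eval_q g * eval_q h" "eval_q (g ^ m) = eval_q g ^ m"
proof -
  show zero: "eval_q 0 = 0" by (simp add: eval_q_def)
  show pCons: "eval_q (pCons c g) = of_int c + Q_mod13 * eval_q g" for c g
    by (simp add: eval_q_def map_poly_pCons)
  show one: "eval_q 1 = 1" by (simp add: one_pCons pCons zero)
  show add: "eval_q (g + h) = eval_q g + eval_q h" for g h
    by (induction g h rule: poly_induct2) (simp_all add: zero pCons algebra_simps)
  show neg: "eval_q (- g) = - eval_q g" for g
    by (induction g) (simp_all add: zero pCons algebra_simps)
  show "eval_q (g - h) = eval_q g - eval_q h"
    using add[of g "- h"] by (simp add: neg)
  show smult: "eval_q (smult c g) = of_int c * eval_q g" for c g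
    by (induction g) (simp_all add: zero pCons algebra_simps)
  show mult: "eval_q (g * h) = eval_q g * eval_q h" for g h
    by (induction g) (simp_all add: zero pCons add smult algebra_simps)
  show "eval_q (g ^ m) = eval_q g ^ m"
    by (induction m) (simp_all add: one mult)
qed

lemma XD_eval_q: "fps_XD (eval_q g) = eval_q (pderiv g) * fps_XD Q_mod13"
proof (induction g)
  case 0
  show ?case by (simp add: eval_q_hom fps_XD_def)
next
  case (pCons c g)
  have "fps_XD (eval_q (pCons c g)) = fps_XD (Q_mod13 * eval_q g)"
    by (simp add: eval_q_hom fps_XD_def flip: fps_of_int)
  then show ?case
    by (simp add: XD_mult pCons.IH pderiv_pCons eval_q_hom algebra_simps)
qed

text \<open>
  The operator \<open>q d/dq + \<kappa> P\<close>, written in terms of \<open>Q\<close> and \<open>R\<close>; here \<open>\<kappa>\<close> stands for \<open>k/24\<close>.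
\<close>

definition nabla :: "int \<Rightarrow> 13 fps \<Rightarrow> 13 fps" where
  "nabla k u = fps_XD u + of_int k * (Q_mod13\<^sup>2 * R_mod13) * u"

text \<open>
  \<open>nabla\<close> exchanges the polynomials in \<open>Q\<close> with the multiples \<open>R s(Q)\<close> of \<open>R\<close>, see \<open>nabla_even\<close> and \<open>nabla_odd\<close>.
  Since \<open>R^2 = 9 Q^3 + 5\<close>, the square of \<open>nabla\<close> acts on polynomials in \<open>Q\<close>. The polynomial \<open>s\<close> is the
  intermediate result.
\<close>

definition two_step :: "int \<Rightarrow> int poly \<Rightarrow> int poly" where
  "two_step k g = (let s = [:-9, 0, 0, 9:] * pderiv g + [:0, 0, k:] * g
     in [:0, 0, -11, 0, 0, 11:] * s + [:5, 0, 0, 9:] * ([:-9, 0, 0, 9:] * pderiv s + [:0, 0, k:] * s))"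

lemma nabla_even:
  "nabla k (eval_q g) = R_mod13 * eval_q ([:-9, 0, 0, 9:] * pderiv g + [:0, 0, k:] * g)"
  by (simp add: nabla_def XD_eval_q XD_Q_mod13 eval_q_hom algebra_simps power2_eq_square power3_eq_cube)

lemma nabla_odd:
  "nabla k (R_mod13 * eval_q s) = eval_q ([:0, 0, -11, 0, 0, 11:] * s)
     + R_mod13\<^sup>2 * eval_q ([:-9, 0, 0, 9:] * pderiv s + [:0, 0, k:] * s)"
  by (simp add: nabla_def XD_mult XD_eval_q XD_Q_mod13 XD_R_mod13 eval_q_hom algebra_simps power2_eq_square power3_eq_cube)

lemma nabla_two_step: "nabla k (nabla k (eval_q g)) = eval_q (two_step k g)"
  unfolding nabla_even nabla_odd two_step_def Let_def R_mod13_sq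
  by (simp add: eval_q_hom algebra_simps power2_eq_square power3_eq_cube)

lemma nabla_12: "(nabla k ^^ 12) 1 = eval_q ((two_step k ^^ 6) 1)"
proof -
  have "(nabla k ^^ (2 * m)) (eval_q 1) = eval_q ((two_step k ^^ m) 1)" for m
    by (induction m) (simp_all add: nabla_two_step)
  from this[of 6] show ?thesis by (simp add: eval_q_hom)
qed

lemma eval_q_eq_0: "[:13:] dvd g \<Longrightarrow> eval_q g = 0"
proof -
  assume "[:13:] dvd g"
  then obtain h where "g = [:13:] * h" by (elim dvdE)
  then have "eval_q g = 13 * eval_q h" by (simp add: eval_q_hom)
  then show ?thesis by (simp add: thirteen_eq_0)
qed

text \<open>
  If a finite computation with polynomials shows that \<open>1 - \<nabla>^12 1\<close> is \<open>c \<Delta>^j\<close> modulo 13, where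
  \<open>\<Delta> = q E^24 = 8 Q^3 - 8\<close>, then \<open>section13_fermat\<close> yields \<open>q^j (section13 j (E^k))^13 = c q^j E^(k + 24 j)\<close>. The exponent
  on the right is a multiple of 13, and 13th roots are unique.
\<close>

lemma section13_euler13_power:
  assumes j: "j < 13" and k: "of_nat (6 * k) = (of_nat (13 - j) :: 13)" "of_nat (13 - j) = (of_int \<kappa> :: 13)"
    and poly: "[:13:] dvd 1 - (two_step \<kappa> ^^ 6) 1 - smult c ([:-8, 0, 0, 8:] ^ j)"
    and l: "k + 24 * j = 13 * l"
  shows "section13 j (euler13 ^ k) = of_int c * euler13 ^ l"
proof -
  have iter: "(fps_XDp (of_nat (13 - j)) ^^ m) (euler13 ^ k * u) = euler13 ^ k * (nabla \<kappa> ^^ m) u" for m u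
  proof (induction m)
    case (Suc m)
    have "fps_const (of_nat (13 - j)) = (of_int \<kappa> :: 13 fps)"
      unfolding k(2) fps_of_int ..
    then show ?case
      using XDp_euler13_power[OF k(1)] by (simp add: Suc.IH nabla_def)
  qed simp
  have delta: "eval_q [:-8, 0, 0, 8:] = fps_X * euler13 ^ 24"
    unfolding delta13 by (simp add: eval_q_hom algebra_simps power3_eq_cube)
  have "eval_q (1 - (two_step \<kappa> ^^ 6) 1) = eval_q (smult c ([:-8, 0, 0, 8:] ^ j))"
    using eval_q_eq_0[OF poly] by (simp add: eval_q_hom)
  then have E: "1 - (nabla \<kappa> ^^ 12) 1 = of_int c * (fps_X * euler13 ^ 24) ^ j"
    unfolding nabla_12 by (simp add: eval_q_hom(2,6,7,9) delta)
  have "fps_X ^ j * section13 j (euler13 ^ k) ^ 13 = euler13 ^ k - (fps_XDp (of_nat (13 - j)) ^^ 12) (euler13 ^ k * 1)"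
    using section13_fermat[OF j, of "euler13 ^ k"] by simp
  also have "\<dots> = euler13 ^ k * (1 - (nabla \<kappa> ^^ 12) 1)"
    unfolding iter by (simp add: algebra_simps)
  also have "\<dots> = fps_X ^ j * (of_int c * euler13 ^ (k + 24 * j))"
    unfolding E power_mult_distrib power_add power_mult by (simp only: mult_ac)
  also have "of_int c * euler13 ^ (k + 24 * j) = (of_int c * euler13 ^ l) ^ 13"
  proof -
    have "(of_int c :: 13 fps) ^ 13 = of_int c"
      by (simp only: fps_of_int[symmetric] fps_const_power power_13)
    then show ?thesis unfolding l by (simp add: power_mult_distrib mult.commute flip: power_mult)
  qed
  finally have eq: "fps_X ^ j * section13 j (euler13 ^ k) ^ 13 = fps_X ^ j * (of_int c * euler13 ^ l) ^ 13" .
  have "section13 j (euler13 ^ k) ^ 13 = (of_int c * euler13 ^ l) ^ 13"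
  proof (rule fps_ext)
    fix n
    show "fps_nth (section13 j (euler13 ^ k) ^ 13) n = fps_nth ((of_int c * euler13 ^ l) ^ 13) n"
      using arg_cong[OF eq, of "\<lambda>f. fps_nth f (n + j)"] by (simp only: fps_X_power_mult_nth) simp
  qed
  then show ?thesis by (rule power_13_inject)
qed

lemma const_dvd_pCons: "[:c:] dvd pCons a g \<longleftrightarrow> c dvd a \<and> [:c:] dvd g" for c :: int
  unfolding const_poly_dvd_iff by (auto simp: coeff_pCons split: nat.splits)

text \<open>
  The parameters 7, 1 and 8 of \<open>two_step\<close> are the residues of \<open>k/24\<close> for \<open>k = 12, 24, 36\<close>, and the constants
  11, 8 and 4 are the residues of the coefficient of \<open>q^j\<close> in \<open>E^k\<close> for \<open>j = 6, 12, 5\<close>.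
\<close>

lemma two_step_12: "[:13:] dvd 1 - (two_step 7 ^^ 6) 1 - smult 11 ([:-8, 0, 0, 8:] ^ 6)"
  by (simp add: two_step_def Let_def pderiv_pCons one_pCons eval_nat_numeral const_dvd_pCons)

lemma two_step_24: "[:13:] dvd 1 - (two_step 1 ^^ 6) 1 - smult 8 ([:-8, 0, 0, 8:] ^ 12)"
  by (simp add: two_step_def Let_def pderiv_pCons one_pCons eval_nat_numeral const_dvd_pCons)

lemma two_step_36: "[:13:] dvd 1 - (two_step 8 ^^ 6) 1 - smult 4 ([:-8, 0, 0, 8:] ^ 5)"
  by (simp add: two_step_def Let_def pderiv_pCons one_pCons eval_nat_numeral const_dvd_pCons)

lemma section13_euler13_12: "section13 6 (euler13 ^ 12) = 11 * euler13 ^ 12"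
  using section13_euler13_power[OF _ _ _ two_step_12, of 12 12] by simp

lemma section13_euler13_24: "section13 12 (euler13 ^ 24) = 8 * euler13 ^ 24"
  using section13_euler13_power[OF _ _ _ two_step_24, of 24 24] by simp

lemma section13_euler13_36: "section13 5 (euler13 ^ 36) = 4 * euler13 ^ 12"
  using section13_euler13_power[OF _ _ _ two_step_36, of 36 12] by simp

section \<open>The theta series of the lattice A12 modulo 13\<close>

text \<open>
  The orbits of \<open>f\<close> partition \<open>A\<close>, and each has exactly \<open>p\<close> elements: if two of the first \<open>p\<close> iterates
  of a point coincided, some point would be fixed by a power of \<open>f\<close> with exponent prime to \<open>p\<close>,
  hence by \<open>f\<close>.
\<close>

lemma prime_dvd_card_fixed_point_free:
  fixes f :: "'a \<Rightarrow> 'a"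
  assumes fin: "finite A" and p: "prime p" and maps: "f ` A \<subseteq> A"
    and period: "\<And>x. x \<in> A \<Longrightarrow> (f ^^ p) x = x" and free: "\<And>x. x \<in> A \<Longrightarrow> f x \<noteq> x"
  shows "p dvd card A"
proof -
  define orb where "orb x = (\<lambda>i. (f ^^ i) x) ` {..<p}" for x
  have p0: "p > 0" using p by (rule prime_gt_0_nat)
  have iter_in: "(f ^^ i) x \<in> A" if "x \<in> A" for i x
    using that maps by (induction i) auto
  have reduce_iter: "(f ^^ (i mod p)) x = (f ^^ i) x" if "x \<in> A" for i x
    using period[OF that] by (rule funpow_mod_eq)
  have orb_range: "orb x = range (\<lambda>i. (f ^^ i) x)" if "x \<in> A" for x
  proof -
    have "(f ^^ i) x \<in> orb x" for i
      unfolding orb_def using p0 reduce_iter[OF that, of i] by (intro image_eqI[of _ _ "i mod p"]) auto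
    then show ?thesis by (auto simp: orb_def)
  qed
  have orb_subset: "orb x \<subseteq> orb y" if "x \<in> A" "y \<in> A" "(f ^^ i) x = (f ^^ j) y" for x y i j
  proof -
    have "(f ^^ k) x = (f ^^ (k + (p * i - i) + j)) y" for k
    proof -
      have "i \<le> p * i" using p0 by simp
      have "(f ^^ (k + (p * i - i) + j)) y = (f ^^ (k + (p * i - i))) ((f ^^ i) x)"
        by (simp add: funpow_add that(3))
      also have "\<dots> = (f ^^ (k + (p * i - i) + i)) x" by (simp add: funpow_add)
      also have "k + (p * i - i) + i = k + p * i" using \<open>i \<le> p * i\<close> by (simp only: add.assoc le_add_diff_inverse2)
      also have "(f ^^ (k + p * i)) x = (f ^^ k) x"
        using reduce_iter[OF that(1), of "k + p * i"] reduce_iter[OF that(1), of k] by simp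
      finally show ?thesis ..
    qed
    then show ?thesis using that(1,2) by (auto simp: orb_range)
  qed
  have card_orb: "card (orb x) = p" if "x \<in> A" for x
  proof -
    have no_collision: "(f ^^ i) x \<noteq> (f ^^ j) x" if "i < j" "j < p" for i j
    proof
      assume eq: "(f ^^ i) x = (f ^^ j) x"
      let ?y = "(f ^^ i) x" and ?d = "j - i"
      have y: "?y \<in> A" using iter_in \<open>x \<in> A\<close> .
      have "(f ^^ ?d) ?y = (f ^^ (?d + i)) x" by (simp add: funpow_add)
      then have d: "(f ^^ ?d) ?y = ?y" using eq that by simp
      have "\<not> p dvd ?d" using that by (auto dest: dvd_imp_le)
      then have "coprime ?d p" using p by (simp add: prime_imp_coprime coprime_commute)
      then have "gcd ?d p = 1" by simp
      moreover have "?d \<noteq> 0" using that by simp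
      then obtain u v where "?d * u = p * v + gcd ?d p"
        using bezout_nat[of ?d p] by blast
      ultimately have uv: "?d * u = p * v + 1" by simp
      have "?y = (f ^^ (?d * u)) ?y"
        using funpow_mod_eq[OF d, of "?d * u"] by simp
      also have "\<dots> = f ((f ^^ (p * v)) ?y)" by (simp add: uv)
      also have "(f ^^ (p * v)) ?y = ?y"
        using reduce_iter[OF y, of "p * v"] by simp
      finally show False using free[OF y] by simp
    qed
    have "inj_on (\<lambda>i. (f ^^ i) x) {..<p}"
      by (rule linorder_inj_onI) (use no_collision in auto)
    then show ?thesis by (simp add: orb_def card_image)
  qed
  have "\<Union> (orb ` A) = A"
  proof
    show "\<Union> (orb ` A) \<subseteq> A" using iter_in by (auto simp: orb_def)
    show "A \<subseteq> \<Union> (orb ` A)" using orb_range by (force intro: range_eqI[of _ _ 0])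
  qed
  moreover have "p dvd card (\<Union> (orb ` A))"
  proof (rule dvd_partition)
    show "finite (\<Union> (orb ` A))" using fin by (simp add: orb_def)
    show "\<forall>c\<in>orb ` A. p dvd card c" using card_orb by auto
    show "\<forall>c1\<in>orb ` A. \<forall>c2\<in>orb ` A. c1 \<noteq> c2 \<longrightarrow> c1 \<inter> c2 = {}"
    proof (clarify, rule ccontr)
      fix x y assume xy: "x \<in> A" "y \<in> A" "orb x \<noteq> orb y" "orb x \<inter> orb y \<noteq> {}"
      then obtain i j where "(f ^^ i) x = (f ^^ j) y" by (auto simp: orb_def)
      then have "orb x = orb y" using orb_subset xy(1,2) by (metis subset_antisym)
      with xy(3) show False by simp
    qed
  qed
  ultimately show ?thesis by simp
qed

text \<open>
  The thirteen coordinates of a vector of the lattice \<open>A\<^sub>1\<^sub>2\<close>, continued periodically. The coordinate with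
  index 0 is the one that is missing in \<open>m\<close>; it makes the sum zero.
\<close>

definition wrap :: "(nat \<Rightarrow> int) \<Rightarrow> nat \<Rightarrow> int" where
  "wrap m i = (if 13 dvd i then - (\<Sum>j=1..12. m j) else m (i mod 13))"

definition rotate_coords :: "(nat \<Rightarrow> int) \<Rightarrow> nat \<Rightarrow> int" where
  "rotate_coords m = (\<lambda>i\<in>{1..12}. wrap m (Suc i))"

lemma wrap_coord: "i \<in> {1..12} \<Longrightarrow> wrap m i = m i"
  by (auto simp: wrap_def dest!: dvd_imp_le)

lemma wrap_mod: "wrap m (i mod 13) = wrap m i"
  by (simp add: wrap_def dvd_mod_iff)

lemma sum_lessThan_13: "(\<Sum>i<13. f i) = f 0 + (\<Sum>i=1..12. f i)" for f :: "nat \<Rightarrow> int"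
proof -
  have "{..<13} = insert 0 {1..12::nat}" by auto
  then show ?thesis by simp
qed

lemma sum_wrap: "(\<Sum>i<13. wrap m i) = 0"
  by (simp add: sum_lessThan_13 wrap_coord) (simp add: wrap_def)

lemma sum_wrap_Suc: "(\<Sum>i<13. g (wrap m (Suc i))) = (\<Sum>i<13. g (wrap m i))" for g :: "int \<Rightarrow> int"
proof -
  have "g (wrap m 13) = g (wrap m 0)" by (simp add: wrap_def)
  then show ?thesis
    using sum.lessThan_Suc_shift[of "\<lambda>i. g (wrap m i)" 13] sum.lessThan_Suc[of "\<lambda>i. g (wrap m i)" 13]
    by linarith
qed

lemma wrap_rotate: "wrap (rotate_coords m) i = wrap m (Suc i)"
proof (cases "13 dvd i")
  case True
  have "wrap (rotate_coords m) i = - (\<Sum>j=1..12. rotate_coords m j)"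
    using True by (simp add: wrap_def)
  also have "(\<Sum>j=1..12. rotate_coords m j) = (\<Sum>j=1..12. wrap m (Suc j))"
    by (rule sum.cong) (simp_all add: rotate_coords_def)
  also have "- \<dots> = wrap m 1"
    using sum_wrap[of m] sum_wrap_Suc[of "\<lambda>x. x" m] sum_lessThan_13[of "\<lambda>i. wrap m (Suc i)"] by simp
  also have "\<dots> = wrap m (Suc i)" using True wrap_mod[of m "Suc i"] by (auto simp: mod_Suc dvd_eq_mod_eq_0)
  finally show ?thesis .
next
  case False
  then have i: "i mod 13 \<in> {1..12}" using mod_less_divisor[of 13 i] by (auto simp: dvd_eq_mod_eq_0)
  have "wrap (rotate_coords m) i = rotate_coords m (i mod 13)"
    using wrap_coord[OF i, of "rotate_coords m"] by (simp only: wrap_mod)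
  also have "\<dots> = wrap m (Suc (i mod 13))"
    using i by (simp add: rotate_coords_def)
  also have "\<dots> = wrap m (Suc i)"
    by (metis mod_Suc_eq wrap_mod)
  finally show ?thesis .
qed

text \<open>
  In the thirteen coordinates the quadratic form becomes half the sum of squares, which makes its
  invariance under rotation visible.
\<close>

lemma frob_form_13: "2 * frob_form 13 m = (\<Sum>i<13. (wrap m i)\<^sup>2)"
proof -
  have "wrap m 0 = - (\<Sum>j=1..12. m j)" by (simp add: wrap_def)
  then show ?thesis
    using frob_form_double[of 13 m] by (simp add: sum_lessThan_13 wrap_coord)
qed

lemma frob_form_rotate: "frob_form 13 (rotate_coords m) = frob_form 13 m"
  using frob_form_13[of m] frob_form_13[of "rotate_coords m"] sum_wrap_Suc[of "\<lambda>x. x\<^sup>2" m]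
  by (simp add: wrap_rotate)

lemma wrap_rotate_iter: "wrap ((rotate_coords ^^ k) m) i = wrap m (i + k)"
  by (induction k arbitrary: i) (simp_all add: wrap_rotate)

lemma wrap_inject:
  assumes "m \<in> {1..12} \<rightarrow>\<^sub>E UNIV" "m' \<in> {1..12} \<rightarrow>\<^sub>E UNIV" "\<And>i. wrap m i = wrap m' i"
  shows "m = m'"
proof (rule PiE_ext[OF assms(1,2)])
  fix i :: nat assume "i \<in> {1..12}"
  then show "m i = m' i" using assms(3)[of i] by (simp add: wrap_coord)
qed

lemma rotate_in: "rotate_coords m \<in> {1..12} \<rightarrow>\<^sub>E UNIV"
  by (simp add: rotate_coords_def)

text \<open>
  A vector fixed by the rotation has equal coordinates, and their sum is zero; so it is the zero vector,
  on which the form vanishes.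
\<close>

lemma dvd_card_frob_form_13: 
  assumes "n > 0"
  shows "13 dvd card {m \<in> {1..12} \<rightarrow>\<^sub>E UNIV. frob_form 13 m = int n}"
proof (rule prime_dvd_card_fixed_point_free[where f = rotate_coords])
  let ?A = "{m \<in> {1..12} \<rightarrow>\<^sub>E UNIV. frob_form 13 m = int n}"
  show "finite ?A" using frob_form_fibre_finite[of 13 "int n"] by simp
  show "prime (13 :: nat)" by simp
  show "rotate_coords ` ?A \<subseteq> ?A" using rotate_in frob_form_rotate by auto
  show "(rotate_coords ^^ 13) m = m" if "m \<in> ?A" for m
  proof (rule wrap_inject)
    have "(rotate_coords ^^ 13) m = rotate_coords ((rotate_coords ^^ 12) m)"
      by (simp add: eval_nat_numeral)
    then show "(rotate_coords ^^ 13) m \<in> {1..12} \<rightarrow>\<^sub>E UNIV" using rotate_in by simp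
    show "wrap ((rotate_coords ^^ 13) m) i = wrap m i" for i
      unfolding wrap_rotate_iter by (simp add: wrap_def)
  qed (use that in simp)
  show "rotate_coords m \<noteq> m" if "m \<in> ?A" for m
  proof
    assume fixed: "rotate_coords m = m"
    have all: "wrap m i = wrap m 0" for i
      by (induction i) (metis, metis fixed wrap_rotate)
    then have "m i = wrap m 0" if "i \<in> {1..12}" for i
      using wrap_coord[OF that, of m] all[of i] by simp
    then have "(\<Sum>j=1..12. m j) = (\<Sum>j=1..12::nat. wrap m 0)" by (intro sum.cong) auto
    moreover have "wrap m 0 = - (\<Sum>j=1..12. m j)" by (simp add: wrap_def)
    ultimately have "wrap m 0 = 0" by simp
    then have "wrap m i = 0" for i using all[of i] by simp
    then have "frob_form 13 m = 0"
      using frob_form_13[of m] by simp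
    then show False using that assms by simp
  qed
qed

lemma frob_theta_nth: "fps_nth (frob_theta 13) n = int (card {m \<in> {1..12} \<rightarrow>\<^sub>E UNIV. frob_form 13 m = int n})"
  using infsumI[OF frob_theta_has_sum[of 13]] by (simp add: frob_theta_def)

lemma frob_theta_nth_0: "fps_nth (frob_theta 13) 0 = 1"
proof -
  have "{m \<in> {1..12} \<rightarrow>\<^sub>E UNIV. frob_form 13 m = 0} = {\<lambda>i\<in>{1..12}. 0}"
  proof (intro equalityI subsetI)
    fix m assume "m \<in> {m \<in> {1..12} \<rightarrow>\<^sub>E UNIV. frob_form 13 m = 0}"
    then have m: "m \<in> {1..12} \<rightarrow>\<^sub>E UNIV" and "frob_form 13 m = 0" by auto
    then have "(\<Sum>i<13. (wrap m i)\<^sup>2) = 0" using frob_form_13[of m] by simp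
    then have z: "wrap m i = 0" if "i < 13" for i
      using that by (simp add: sum_nonneg_eq_0_iff)
    have "m i = 0" if "i \<in> {1..12}" for i
      using z[of i] that wrap_coord[of i m] by auto
    then show "m \<in> {\<lambda>i\<in>{1..12}. 0}" using m by (auto intro!: PiE_ext[OF m])
  qed (auto simp: frob_form_def)
  then show ?thesis by (simp add: frob_theta_nth)
qed

section \<open>Iterating the sections of the partition series\<close>

definition "partition13 = reduce partition_series"

lemma partition13_euler13: "partition13 * euler13 = 1"
  unfolding partition13_def euler13_def reduce_hom(6)[symmetric] partition_euler by (rule reduce_hom)

lemma frob_factor_power:
  assumes "n > 0"
  shows "frob_factor k n = frob_factor 1 n ^ k"
proof -
  have "(1 - fps_X ^ n) ^ k * frob_factor 1 n ^ k = 1"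
    using frob_factor_correct[OF assms, of 1] by (simp flip: power_mult_distrib)
  moreover have "frob_factor k n * ((1 - fps_X ^ n) ^ k * frob_factor 1 n ^ k)
      = ((1 - fps_X ^ n) ^ k * frob_factor k n) * frob_factor 1 n ^ k"
    by (simp only: mult_ac)
  ultimately show ?thesis using frob_factor_correct[OF assms, of k] by simp
qed

lemma fps_nth_power_cong:
  fixes f g :: "int fps"
  assumes "\<And>i. i \<le> n \<Longrightarrow> fps_nth f i = fps_nth g i"
  shows "i \<le> n \<Longrightarrow> fps_nth (f ^ k) i = fps_nth (g ^ k) i"
  using assms by (induction k arbitrary: i) (simp_all add: fps_mult_nth)

lemma frob_prod_eq_partition_power: "(\<Prod>n. frob_factor k (Suc n)) = partition_series ^ k"
proof (rule fps_ext)
  fix m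
  have "fps_nth (\<Prod>n. frob_factor k (Suc n)) m = fps_nth ((\<Prod>i\<le>m. frob_factor 1 (Suc i)) ^ k) m"
    unfolding frob_factor_prod_nth[OF order_refl] prod_power_distrib by (simp only: frob_factor_power[of _ k] zero_less_Suc)
  also have "\<dots> = fps_nth (partition_series ^ k) m"
    by (rule fps_nth_power_cong[of m]) (simp_all only: partition_series_def frob_factor_prod_nth order_refl)
  finally show "fps_nth (\<Prod>n. frob_factor k (Suc n)) m = fps_nth (partition_series ^ k) m" .
qed

lemma reduce_frob_theta: "reduce (frob_theta 13) = 1"
proof (rule fps_ext)
  fix n
  show "fps_nth (reduce (frob_theta 13)) n = fps_nth (1 :: 13 fps) n"
  proof (cases "n = 0")
    case False
    then show ?thesis
      using dvd_card_frob_form_13[of n] by (simp add: reduce_nth frob_theta_nth of_nat_13_eq_0)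
  qed (simp add: reduce_nth frob_theta_nth_0)
qed

text \<open>
  Modulo 13 the theta series disappears, and colouring with 13 colours amounts to the substitution of
  \<open>q^13\<close> for \<open>q\<close> in the generating function of ordinary partitions.
\<close>

lemma reduce_cphi_gf: "reduce (cphi_gf 13) = partition13 ^ 13"
  by (simp add: cphi_gf_def reduce_hom reduce_frob_theta frob_prod_eq_partition_power partition13_def)

lemma euler13_power_eq: "euler13 ^ n = euler13 ^ (n + 13) * partition13 ^ 13"
proof -
  have "euler13 ^ (n + 13) * partition13 ^ 13 = euler13 ^ n * (partition13 * euler13) ^ 13"
    by (simp only: power_add power_mult_distrib mult_ac)
  then show ?thesis by (simp add: partition13_euler13)
qed

lemma euler13_Suc_partition13: "euler13 ^ Suc n * partition13 = euler13 ^ n"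
proof -
  have "euler13 ^ Suc n * partition13 = euler13 ^ n * (partition13 * euler13)" by (simp add: mult_ac)
  then show ?thesis by (simp add: partition13_euler13)
qed

text \<open>
  \<open>F\<close>, \<open>E^11\<close> and \<open>E^23\<close> are the products of \<open>E^12\<close>, \<open>E^24\<close> and \<open>E^36\<close> with \<open>F^13\<close>. By
  \<open>section13_mult_power\<close> the factor \<open>F^13\<close> contributes a factor \<open>F\<close> to the section.
\<close>

lemma partition13_section: "fps_nth partition13 (13 * n + 6) = 11 * fps_nth (euler13 ^ 11) n"
proof -
  have "partition13 ^ 13 = partition13 * partition13 ^ 12" by (simp flip: power_Suc)
  then have "euler13 ^ 12 * partition13 ^ 13 = partition13 * (partition13 * euler13) ^ 12"
    by (simp only: power_mult_distrib mult_ac)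
  then have "partition13 = euler13 ^ 12 * partition13 ^ 13" by (simp add: partition13_euler13)
  then have "section13 6 partition13 = 11 * (euler13 ^ 12 * partition13)"
    using section13_mult_power[of 6 "euler13 ^ 12" partition13] by (simp add: section13_euler13_12 mult.assoc)
  then have "section13 6 partition13 = 11 * euler13 ^ 11" using euler13_Suc_partition13[of 11] by simp
  then have "fps_nth (section13 6 partition13) n = fps_nth (11 * euler13 ^ 11) n" by simp
  then show ?thesis by (simp add: section13_def numeral_fps_const)
qed

lemma euler13_11_section: "fps_nth (euler13 ^ 11) (13 * n + 12) = 8 * fps_nth (euler13 ^ 23) n"
proof -
  have "section13 12 (euler13 ^ 11) = 8 * (euler13 ^ 24 * partition13)"
    using section13_mult_power[of 12 "euler13 ^ 24" partition13] euler13_power_eq[of 11] by (simp add: section13_euler13_24 mult.assoc)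
  then have "section13 12 (euler13 ^ 11) = 8 * euler13 ^ 23" using euler13_Suc_partition13[of 23] by simp
  then have "fps_nth (section13 12 (euler13 ^ 11)) n = fps_nth (8 * euler13 ^ 23) n" by simp
  then show ?thesis by (simp add: section13_def numeral_fps_const)
qed

lemma euler13_23_section: "fps_nth (euler13 ^ 23) (13 * n + 5) = 4 * fps_nth (euler13 ^ 11) n"
proof -
  have "section13 5 (euler13 ^ 23) = 4 * (euler13 ^ 12 * partition13)"
    using section13_mult_power[of 5 "euler13 ^ 36" partition13] euler13_power_eq[of 23] by (simp add: section13_euler13_36 mult.assoc)
  then have "section13 5 (euler13 ^ 23) = 4 * euler13 ^ 11" using euler13_Suc_partition13[of 11] by simp
  then have "fps_nth (section13 5 (euler13 ^ 23)) n = fps_nth (4 * euler13 ^ 11) n" by simp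
  then show ?thesis by (simp add: section13_def numeral_fps_const)
qed

text \<open>
  The recursion composes the two progressions \<open>13 n + 12\<close> and \<open>13 n + 5\<close>, along which \<open>E^11\<close> passes to a multiple
  of \<open>E^23\<close> and back. Starting from 0, it follows the constant term of \<open>E^11\<close>.
\<close>

fun witness_index :: "nat \<Rightarrow> nat" where
  "witness_index 0 = 0"
| "witness_index (Suc s) = 13 * (13 * witness_index s + 5) + 12"

lemma witness_index_closed: "24 * int (witness_index s) = 11 * (169 ^ s - 1)"
  by (induction s) simp_all

lemma euler13_11_witness_index: "fps_nth (euler13 ^ 11) (witness_index s) = 6 ^ s"
proof (induction s)
  case 0
  show ?case by (simp add: fps_nth_power_0 euler13_def reduce_nth euler_series_nth_0)
next
  case (Suc s)
  have "fps_nth (euler13 ^ 11) (witness_index (Suc s)) = 8 * (4 * 6 ^ s)"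
    by (simp only: witness_index.simps euler13_11_section euler13_23_section Suc.IH)
  also have "\<dots> = 32 * 6 ^ s" by simp
  also have "(32 :: 13) = 6" by simp
  finally show ?case by simp
qed

theorem corollary1p8:
  fixes r :: nat
  assumes "r > 0"
  shows "\<exists>m::int. \<not> [cphi 13 (13 ^ (2 * r) * m + (13 - 13 ^ (2 * r + 1)) div 24) = 0] (mod 13)"
proof
  obtain s where r: "r = Suc s" using assms by (cases r) auto
  define K :: int where "K = 169 ^ s"
  have pow: "(13 :: int) ^ (2 * r) = 169 * K" "(13 :: int) ^ (2 * r + 1) = 2197 * K"
    by (simp_all add: r K_def power_mult)
  \<comment> \<open>With \<open>m = 1\<close> the argument is \<open>(11 * 13^(2 r) + 13) / 24\<close>, which is 13 times an index reached by the recursion.\<close>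
  have "(13 - 2197 * K) = 24 * (169 * int (witness_index s) + 78 - 169 * K)"
    using witness_index_closed[of s] by (simp add: K_def)
  then have arg: "13 ^ (2 * r) * 1 + (13 - 13 ^ (2 * r + 1)) div 24 = int (13 * (13 * witness_index s + 6))"
    unfolding pow by simp
  have "of_int (cphi 13 (int (13 * (13 * witness_index s + 6)))) = fps_nth (reduce (cphi_gf 13)) (13 * (13 * witness_index s + 6))"
    unfolding cphi_def reduce_nth by (simp only: nat_int of_nat_less_0_iff if_False)
  also have "\<dots> = fps_nth partition13 (13 * witness_index s + 6)"
    unfolding reduce_cphi_gf by (simp add: power_13_nth)
  also have "\<dots> = 11 * 6 ^ s"
    by (simp add: partition13_section euler13_11_witness_index)
  also have "\<dots> \<noteq> (0 :: 13)"
  proof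
    assume "11 * 6 ^ s = (0 :: 13)"
    then have "11 * 6 ^ s * 11 ^ s = (0 :: 13)" by simp
    then have "11 * 66 ^ s = (0 :: 13)" by (simp add: mult.assoc flip: power_mult_distrib)
    moreover have "(66 :: 13) = 1" by simp
    ultimately show False by simp
  qed
  finally have "of_int (cphi 13 (int (13 * (13 * witness_index s + 6)))) \<noteq> (of_int 0 :: 13)" by simp
  then show "\<not> [cphi 13 (13 ^ (2 * r) * 1 + (13 - 13 ^ (2 * r + 1)) div 24) = 0] (mod 13)"
    unfolding arg of_int_eq_iff_cong_CHAR by simp
qed

end
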